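(* Let $W$ be a right-angled Coxeter group. If $S$ and $S'$ are finite Coxeter generating sets for $W$, then the Coxeter systems $(W,S)$ and $(W,S')$ are equivalent; that is, there is an automorphism $\phi\colon W\to W$ such that $\phi(S)=S'$.
   Context: A Coxeter system is a pair $(W,S)$ in which $W$ is a group, $S\subseteq W$ is a finite subset, and $W$ has a presentation $W=\langle S \mid (st)^{m(s,t)}=1 \text{ for } s,t\in S\rangle$, where $m(s,s)=1$ for every $s\in S$ and $m(s,t)=m(t,s)\in\{2,3,4,\ldots,\infty\}$ for $s\neq t$; the relation $(st)^{m(s,t)}=1$ is omitted when $m(s,t)=\infty$. (In a Coxeter system $m(s,t)$ is the order of $st$ in $W$.) A set $S$ occurring in such a presentation is called a Coxeter generating set for $W$. Two Coxeter systems $(W,S)$ and $(W',S')$ are equivalent if there is a group isomorphism $\phi\colon W\to W'$ with $\phi(S)=S'$. A Coxeter system $(W,S)$ is right-angled if $m(s,t)\in\{2,\infty\}$ whenever $s\neq t$. A group $W$ is a right-angled Coxeter group if it admits at least one Coxeter generating set $S_0$ such that $(W,S_0)$ is right-angled. In the statement, $S$ and $S'$ are arbitrary Coxeter generating sets, not assumed to give right-angled systems. *)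

theory Defs
  imports "HOL-Algebra.Group" "HOL-Library.Extended_Nat"
begin

text \<open>A letter \<open>(s, True)\<close> stands for the generator \<open>s\<close>, and \<open>(s, False)\<close> for its formal inverse.\<close>

definition group_words :: "'a set \<Rightarrow> ('a \<times> bool) list set" where
  "group_words S = lists (S \<times> UNIV)"

inductive word_equiv ::
  "'a set \<Rightarrow> ('a \<times> bool) list set \<Rightarrow> ('a \<times> bool) list \<Rightarrow> ('a \<times> bool) list \<Rightarrow> bool"
  for S R where
  refl: "w \<in> group_words S \<Longrightarrow> word_equiv S R w w"
| sym: "word_equiv S R v w \<Longrightarrow> word_equiv S R w v"
| trans: "word_equiv S R u v \<Longrightarrow> word_equiv S R v w \<Longrightarrow> word_equiv S R u w"
| cancel: "u \<in> group_words S \<Longrightarrow> v \<in> group_words S \<Longrightarrow> s \<in> S \<Longrightarrow>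
    word_equiv S R (u @ [(s, b), (s, \<not> b)] @ v) (u @ v)"
| relator: "u \<in> group_words S \<Longrightarrow> v \<in> group_words S \<Longrightarrow> r \<in> R \<Longrightarrow>
    word_equiv S R (u @ r @ v) (u @ v)"

definition word_class ::
  "'a set \<Rightarrow> ('a \<times> bool) list set \<Rightarrow> ('a \<times> bool) list \<Rightarrow> ('a \<times> bool) list set" where
  "word_class S R w = {v. word_equiv S R w v}"

text \<open>The group \<open>\<langle>S | R\<rangle>\<close>; the relators are meant to satisfy \<open>R \<subseteq> group_words S\<close>.\<close>

definition presented_group ::
  "'a set \<Rightarrow> ('a \<times> bool) list set \<Rightarrow> ('a \<times> bool) list set monoid" where
  "presented_group S R =
     \<lparr>carrier = word_class S R ` group_words S,
      mult = (\<lambda>A B. \<Union>u\<in>A. \<Union>v\<in>B. word_class S R (u @ v)),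
      one = word_class S R []\<rparr>"

definition has_presentation ::
  "('a, 'b) monoid_scheme \<Rightarrow> 'a set \<Rightarrow> ('a \<times> bool) list set \<Rightarrow> bool" where
  "has_presentation G S R \<longleftrightarrow>
     group G \<and> S \<subseteq> carrier G \<and>
     (\<exists>\<phi> \<in> iso (presented_group S R) G. \<forall>s\<in>S. \<phi> (word_class S R [(s, True)]) = s)"

definition coxeter_matrix :: "'a set \<Rightarrow> ('a \<Rightarrow> 'a \<Rightarrow> enat) \<Rightarrow> bool" where
  "coxeter_matrix S m \<longleftrightarrow>
     (\<forall>s\<in>S. m s s = 1) \<and>
     (\<forall>s\<in>S. \<forall>t\<in>S. s \<noteq> t \<longrightarrow> m s t = m t s \<and> 2 \<le> m s t)"

definition coxeter_relators :: "'a set \<Rightarrow> ('a \<Rightarrow> 'a \<Rightarrow> enat) \<Rightarrow> ('a \<times> bool) list set" where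
  "coxeter_relators S m =
     {concat (replicate n [(s, True), (t, True)]) | s t n. s \<in> S \<and> t \<in> S \<and> m s t = enat n}"

definition coxeter_system_with ::
  "('a, 'b) monoid_scheme \<Rightarrow> 'a set \<Rightarrow> ('a \<Rightarrow> 'a \<Rightarrow> enat) \<Rightarrow> bool" where
  "coxeter_system_with W S m \<longleftrightarrow>
     finite S \<and> coxeter_matrix S m \<and> has_presentation W S (coxeter_relators S m)"

definition coxeter_system :: "('a, 'b) monoid_scheme \<Rightarrow> 'a set \<Rightarrow> bool" where
  "coxeter_system W S \<longleftrightarrow> (\<exists>m. coxeter_system_with W S m)"

definition right_angled_coxeter_system :: "('a, 'b) monoid_scheme \<Rightarrow> 'a set \<Rightarrow> bool" where
  "right_angled_coxeter_system W S \<longleftrightarrow>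
     (\<exists>m. coxeter_system_with W S m \<and>
          (\<forall>s\<in>S. \<forall>t\<in>S. s \<noteq> t \<longrightarrow> m s t \<in> {2, \<infinity>}))"

definition right_angled_coxeter_group :: "('a, 'b) monoid_scheme \<Rightarrow> bool" where
  "right_angled_coxeter_group W \<longleftrightarrow> (\<exists>S\<^sub>0. right_angled_coxeter_system W S\<^sub>0)"

definition coxeter_systems_equivalent ::
  "('a, 'b) monoid_scheme \<Rightarrow> 'a set \<Rightarrow> ('c, 'd) monoid_scheme \<Rightarrow> 'c set \<Rightarrow> bool" where
  "coxeter_systems_equivalent W S W' S' \<longleftrightarrow> (\<exists>\<phi> \<in> iso W W'. \<phi> ` S = S')"


lemma word_equiv_in_words:
  assumes "word_equiv S R v w" "R \<subseteq> group_words S"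
  shows "v \<in> group_words S \<and> w \<in> group_words S"
  using assms by (induction rule: word_equiv.induct) (auto simp: group_words_def)

lemma word_equiv_context:
  assumes "word_equiv S R v w" "x \<in> group_words S" "y \<in> group_words S"
  shows "word_equiv S R (x @ v @ y) (x @ w @ y)"
  using assms
proof (induction rule: word_equiv.induct)
  case (refl w)
  then show ?case by (intro word_equiv.refl) (auto simp: group_words_def)
next
  case (sym v w)
  then show ?case by (blast intro: word_equiv.sym)
next
  case (trans u v w)
  then show ?case by (blast intro: word_equiv.trans)
next
  case (cancel u v s b)
  then show ?case
    using word_equiv.cancel[of "x @ u" S "v @ y" s R b] by (simp add: group_words_def)
next
  case (relator u v r)
  then show ?case
    using word_equiv.relator[of "x @ u" S "v @ y" r R] by (simp add: group_words_def)
qed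

lemma word_equiv_append:
  assumes "word_equiv S R u u'" "word_equiv S R v v'" "R \<subseteq> group_words S"
  shows "word_equiv S R (u @ v) (u' @ v')"
proof -
  have "[] \<in> group_words S" by (simp add: group_words_def)
  then have "word_equiv S R (u @ v) (u' @ v)" "word_equiv S R (u' @ v) (u' @ v')"
    using word_equiv_context[OF assms(1), of "[]" v] word_equiv_context[OF assms(2), of u' "[]"]
      word_equiv_in_words[OF assms(1,3)] word_equiv_in_words[OF assms(2,3)] by auto
  then show ?thesis by (rule word_equiv.trans)
qed

lemma word_class_eq_iff:
  assumes "v \<in> group_words S" "w \<in> group_words S"
  shows "word_class S R v = word_class S R w \<longleftrightarrow> word_equiv S R v w"
  using assms unfolding word_class_def
  by (blast intro: word_equiv.refl word_equiv.sym word_equiv.trans)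

lemma presented_group_mult:
  assumes "R \<subseteq> group_words S" "u \<in> group_words S" "v \<in> group_words S"
  shows "word_class S R u \<otimes>\<^bsub>presented_group S R\<^esub> word_class S R v = word_class S R (u @ v)"
proof -
  have "word_class S R (u' @ v') = word_class S R (u @ v)"
    if "word_equiv S R u u'" "word_equiv S R v v'" for u' v'
    using word_equiv_append[OF that assms(1)] unfolding word_class_def
    by (blast intro: word_equiv.sym word_equiv.trans)
  moreover have "word_equiv S R u u" "word_equiv S R v v"
    using assms by (auto intro: word_equiv.refl)
  ultimately have "(\<Union>u'\<in>{u'. word_equiv S R u u'}. \<Union>v'\<in>{v'. word_equiv S R v v'}.
      word_class S R (u' @ v')) = word_class S R (u @ v)"
    by blast
  then show ?thesis
    by (simp add: presented_group_def word_class_def[of S R u] word_class_def[of S R v])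
qed

lemma word_equiv_inverse:
  assumes "w \<in> group_words S"
  shows "word_equiv S R (rev (map (\<lambda>(s, b). (s, \<not> b)) w) @ w) []"
  using assms
proof (induction w)
  case Nil
  then show ?case by (simp add: word_equiv.refl group_words_def)
next
  case (Cons a w)
  obtain s b where a: "a = (s, b)" by (cases a)
  let ?w' = "rev (map (\<lambda>(s, b). (s, \<not> b)) w)"
  have *: "w \<in> group_words S" "?w' \<in> group_words S" "s \<in> S"
    using Cons.prems a by (auto simp: group_words_def in_lists_conv_set)
  have "word_equiv S R (?w' @ [(s, \<not> b), (s, b)] @ w) (?w' @ w)"
    using word_equiv.cancel[OF *(2,1,3), of R "\<not> b"] by simp
  then show ?case using Cons.IH[OF *(1)] a by (auto intro: word_equiv.trans)
qed

lemma group_presented_group: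
  assumes R: "R \<subseteq> group_words S"
  shows "group (presented_group S R)"
proof (rule groupI)
  let ?G = "presented_group S R"
  have carr: "carrier ?G = word_class S R ` group_words S"
    and one: "\<one>\<^bsub>?G\<^esub> = word_class S R []" by (auto simp: presented_group_def)
  have nil: "[] \<in> group_words S" by (simp add: group_words_def)
  have app: "u @ v \<in> group_words S" if "u \<in> group_words S" "v \<in> group_words S" for u v
    using that by (simp add: group_words_def)
  note mult = presented_group_mult[OF R]
  show "x \<otimes>\<^bsub>?G\<^esub> y \<in> carrier ?G" if "x \<in> carrier ?G" "y \<in> carrier ?G" for x y
    using that by (auto simp: carr mult app)
  show "\<one>\<^bsub>?G\<^esub> \<in> carrier ?G" using nil by (simp add: carr one)
  show "x \<otimes>\<^bsub>?G\<^esub> y \<otimes>\<^bsub>?G\<^esub> z = x \<otimes>\<^bsub>?G\<^esub> (y \<otimes>\<^bsub>?G\<^esub> z)"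
    if "x \<in> carrier ?G" "y \<in> carrier ?G" "z \<in> carrier ?G" for x y z
    using that by (auto simp: carr mult app)
  show "\<one>\<^bsub>?G\<^esub> \<otimes>\<^bsub>?G\<^esub> x = x" if "x \<in> carrier ?G" for x
    using that nil by (auto simp: carr one mult)
  show "\<exists>y\<in>carrier ?G. y \<otimes>\<^bsub>?G\<^esub> x = \<one>\<^bsub>?G\<^esub>" if x: "x \<in> carrier ?G" for x
  proof -
    obtain w where w: "w \<in> group_words S" "x = word_class S R w" using x carr by auto
    let ?w' = "rev (map (\<lambda>(s, b). (s, \<not> b)) w)"
    have w': "?w' \<in> group_words S"
      using w(1) by (auto simp: group_words_def in_lists_conv_set)
    then have "word_class S R ?w' \<otimes>\<^bsub>?G\<^esub> x = \<one>\<^bsub>?G\<^esub>"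
      using word_equiv_inverse[OF w(1), of R] word_class_eq_iff[OF app[OF w' w(1)] nil, of R]
      by (simp add: mult w one)
    then show ?thesis using w' carr by blast
  qed
qed

lemma coxeter_relators_subset: "coxeter_relators S m \<subseteq> group_words S"
  by (auto simp: coxeter_relators_def group_words_def in_lists_conv_set split: if_splits)

end

theory Submission
  imports Defs
begin

text \<open>
  Every notion used to compare \<open>S\<close> and \<open>S'\<close> is a notion of the group \<open>W\<close> alone.

  Let \<open>(W, S)\<close> be right-angled. Abelianising, an element \<open>w\<close> is remembered by its \<^emph>\<open>support\<close>: the
  set of generators that occur an odd number of times in a word for \<open>w\<close>. This is a homomorphism from
  \<open>W\<close> onto the \<open>\<F>\<^sub>2\<close>-vector space of subsets of \<open>S\<close>. The supports of the elements \<open>w\<close> with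
  \<open>w\<^sup>2 = 1\<close> are exactly the sets of pairwise commuting generators: if \<open>s\<close> and \<open>t\<close> do not commute and
  both lie in the support of \<open>w\<close>, then \<open>w\<close> maps to a nontrivial translation in the infinite dihedral
  group generated by \<open>s\<close> and \<open>t\<close>, where the other generators are sent to \<open>1\<close>
  (\<open>involution_support_commuting\<close>).

  Given a second right-angled generating set \<open>S'\<close>, both spaces of subsets are the largest elementary
  abelian 2-quotient of \<open>W\<close>, so there is a linear bijection from the subsets of \<open>S\<close> to those of \<open>S'\<close>
  that matches the cliques of the two commutation graphs. It need not map singletons to
  singletons, but it maps the power set of a maximal clique onto the power set of a maximal clique,
  because a linear subspace that consists of cliques has a clique as its union
  (\<open>maximal_clique_image\<close>). Comparing dimensions, every intersection of maximal cliques has as many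
  elements as the corresponding intersection on the other side. So the number of vertices lying in
  precisely a prescribed collection of maximal cliques is the same for both graphs, and a bijection
  that respects these collections is an isomorphism of graphs (\<open>clique_preserving_imp_graph_iso\<close>). An
  isomorphism of commutation graphs extends to an automorphism of \<open>W\<close> by the presentation.

  It remains to see that an arbitrary Coxeter generating set \<open>S\<close> of \<open>W\<close> is right-angled. If \<open>m(s,t)\<close>
  is finite, then \<open>st\<close> has finite order, so it is enough that elements of finite order in a
  right-angled Coxeter group have order at most 2 (\<open>torsion_square\<close>): then \<open>s\<close> and \<open>t\<close> commute. For
  this, take the geometric representation of a right-angled system. It has integer entries, each of
  its elements is congruent to the identity modulo 2, and by a lemma of Minkowski an integer matrix of
  finite order that is congruent to the identity modulo 4 is the identity; apply it to squares. Since
  the geometric representation is faithful (\<open>action_faithful\<close>), the square of an element of finite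
  order is \<open>1\<close>.
\<close>

section \<open>The universal property of a Coxeter presentation\<close>

locale coxeter =
  fixes W :: "('a, 'b) monoid_scheme" (structure) and S :: "'a set" and m :: "'a \<Rightarrow> 'a \<Rightarrow> enat"
  assumes system: "coxeter_system_with W S m"

text \<open>A letter and its formal inverse get the same value, since generators are involutions.\<close>

definition word_value :: "('c, 'd) monoid_scheme \<Rightarrow> ('a \<Rightarrow> 'c) \<Rightarrow> ('a \<times> bool) list \<Rightarrow> 'c" where
  "word_value H g u = foldr (\<lambda>a x. g (fst a) \<otimes>\<^bsub>H\<^esub> x) u \<one>\<^bsub>H\<^esub>"

lemma word_value_simps [simp]:
  "word_value H g [] = \<one>\<^bsub>H\<^esub>"
  "word_value H g (a # u) = g (fst a) \<otimes>\<^bsub>H\<^esub> word_value H g u"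
  by (simp_all add: word_value_def)

lemma group_words_simps [simp]:
  "[] \<in> group_words S"
  "a # u \<in> group_words S \<longleftrightarrow> fst a \<in> S \<and> u \<in> group_words S"
  "u @ v \<in> group_words S \<longleftrightarrow> u \<in> group_words S \<and> v \<in> group_words S"
  by (auto simp: group_words_def mem_Times_iff)

lemma word_value_closed:
  assumes "monoid H" "g \<in> S \<rightarrow> carrier H" "u \<in> group_words S"
  shows "word_value H g u \<in> carrier H"
  using assms(3) by (induction u) (use assms(1,2) in \<open>auto intro!: monoid.m_closed\<close>)

lemma word_value_append:
  assumes "monoid H" "g \<in> S \<rightarrow> carrier H" "u \<in> group_words S" "v \<in> group_words S"
  shows "word_value H g (u @ v) = word_value H g u \<otimes>\<^bsub>H\<^esub> word_value H g v"
  using assms(3)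
proof (induction u)
  case Nil
  then show ?case
    using assms word_value_closed[OF assms(1,2,4)] by (simp add: monoid.l_one)
next
  case (Cons a u)
  then show ?case
    using assms word_value_closed[OF assms(1,2)] by (auto simp: monoid.m_assoc Pi_iff)
qed

lemma word_value_alternating:
  assumes "monoid H" "g \<in> S \<rightarrow> carrier H" "s \<in> S" "t \<in> S"
  shows "word_value H g (concat (replicate n [(s, b), (t, c)])) = (g s \<otimes>\<^bsub>H\<^esub> g t) [^]\<^bsub>H\<^esub> n"
proof (induction n)
  case 0
  then show ?case using assms by (simp add: monoid.nat_pow_0)
next
  case (Suc n)
  interpret monoid H by fact
  have "g s \<in> carrier H" "g t \<in> carrier H" using assms by auto
  then have "(g s \<otimes>\<^bsub>H\<^esub> g t) [^]\<^bsub>H\<^esub> Suc n = g s \<otimes>\<^bsub>H\<^esub> (g t \<otimes>\<^bsub>H\<^esub> (g s \<otimes>\<^bsub>H\<^esub> g t) [^]\<^bsub>H\<^esub> n)"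
    by (subst nat_pow_Suc2) (simp_all add: m_assoc)
  then show ?case using Suc by simp
qed

text \<open>Soundness of the presentation: a map \<open>g\<close> into \<open>H\<close> that satisfies the relations sends equivalent
  words to equal elements. The case \<open>s = t\<close> of the relations says that \<open>g s\<close> is an involution, which is
  what makes ignoring the sign of letters harmless.\<close>

lemma word_equiv_word_value:
  assumes "word_equiv S (coxeter_relators S m) u v" and "\<And>s. s \<in> S \<Longrightarrow> m s s = 1"
    and H: "monoid H" "g \<in> S \<rightarrow> carrier H"
    and rel: "\<And>s t n. s \<in> S \<Longrightarrow> t \<in> S \<Longrightarrow> m s t = enat n \<Longrightarrow> (g s \<otimes>\<^bsub>H\<^esub> g t) [^]\<^bsub>H\<^esub> n = \<one>\<^bsub>H\<^esub>"
  shows "word_value H g u = word_value H g v"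
proof -
  interpret monoid H by fact
  note clo = word_value_closed[OF H] and app = word_value_append[OF H]
  show ?thesis using assms(1)
  proof (induction rule: word_equiv.induct)
    case (cancel u v s b)
    have s: "g s \<in> carrier H" using H cancel by auto
    have "g s \<otimes>\<^bsub>H\<^esub> g s = \<one>\<^bsub>H\<^esub>"
      using rel[of s s 1] assms(2)[of s] cancel s by (simp add: one_enat_def)
    then have "g s \<otimes>\<^bsub>H\<^esub> (g s \<otimes>\<^bsub>H\<^esub> word_value H g v) = word_value H g v"
      using s clo[OF cancel(2)] by (simp flip: m_assoc)
    then show ?case using cancel by (simp add: app)
  next
    case (relator u v r)
    obtain s t n where r: "r = concat (replicate n [(s, True), (t, True)])" "s \<in> S" "t \<in> S"
      "m s t = enat n"
      using relator(3) by (auto simp: coxeter_relators_def)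
    have "r \<in> group_words S" using relator coxeter_relators_subset by blast
    moreover have "word_value H g r = \<one>\<^bsub>H\<^esub>"
      using r rel by (simp add: word_value_alternating[OF H])
    ultimately show ?case using relator by (simp add: app clo)
  qed auto
qed

context coxeter
begin

lemma is_group: "group W" and finite_S: "finite S" and S_carrier: "S \<subseteq> carrier W"
  and label_diag: "s \<in> S \<Longrightarrow> m s s = 1"
  and label_ge2: "s \<in> S \<Longrightarrow> t \<in> S \<Longrightarrow> s \<noteq> t \<Longrightarrow> 2 \<le> m s t"
  using system by (auto simp: coxeter_system_with_def has_presentation_def coxeter_matrix_def)

sublocale group W by (rule is_group)

lemma gen_closed [simp]: "s \<in> S \<Longrightarrow> s \<in> carrier W"
  using S_carrier by auto

text \<open>The isomorphism \<open>\<phi>\<close> of the presentation is evaluation of words. Once this is known,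
  \<open>\<phi>\<close> is not needed any more: words represent all elements of \<open>W\<close>, and two words have the same value
  exactly if they are equivalent.\<close>

lemma word_evaluation:
  shows gen_square: "s \<in> S \<Longrightarrow> s \<otimes> s = \<one>"
    and word_value_eq_iff:
      "u \<in> group_words S \<Longrightarrow> v \<in> group_words S \<Longrightarrow>
        word_value W (\<lambda>s. s) u = word_value W (\<lambda>s. s) v \<longleftrightarrow>
        word_equiv S (coxeter_relators S m) u v"
    and ex_word_value: "w \<in> carrier W \<Longrightarrow> \<exists>u\<in>group_words S. word_value W (\<lambda>s. s) u = w"
proof -
  let ?R = "coxeter_relators S m"
  let ?P = "presented_group S ?R"
  obtain \<phi> where \<phi>: "\<phi> \<in> iso ?P W" and \<phi>_gen: "\<And>s. s \<in> S \<Longrightarrow> \<phi> (word_class S ?R [(s, True)]) = s"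
    using system by (auto simp: coxeter_system_with_def has_presentation_def)
  define f where "f u = \<phi> (word_class S ?R u)" for u
  have carr: "carrier ?P = word_class S ?R ` group_words S"
    by (simp add: presented_group_def)
  have bij: "bij_betw \<phi> (carrier ?P) (carrier W)" and hom: "\<phi> \<in> hom ?P W"
    using \<phi> by (auto simp: iso_def)
  have f_closed: "f u \<in> carrier W" if "u \<in> group_words S" for u
    using bij that unfolding f_def carr by (auto simp: bij_betw_def)
  have f_append: "f (u @ v) = f u \<otimes> f v" if "u \<in> group_words S" "v \<in> group_words S" for u v
    using hom that unfolding f_def carr hom_def
    by (auto simp: presented_group_mult[OF coxeter_relators_subset])
  have f_eq: "f u = f v \<longleftrightarrow> word_equiv S ?R u v" if "u \<in> group_words S" "v \<in> group_words S" for u v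
  proof -
    have "f u = f v \<longleftrightarrow> word_class S ?R u = word_class S ?R v"
      using bij that unfolding f_def bij_betw_def carr by (auto dest: inj_onD)
    then show ?thesis using that by (simp add: word_class_eq_iff)
  qed
  have f_nil: "f [] = \<one>"
    using f_append[of "[]" "[]"] f_closed[of "[]"] by simp
  have sq: "s \<otimes> s = \<one>" if s: "s \<in> S" for s
  proof -
    have "[(s, True), (s, True)] \<in> ?R"
      unfolding coxeter_relators_def using s label_diag[of s]
      by (intro CollectI exI[of _ s] exI[of _ 1]) (simp add: one_enat_def)
    then have "word_equiv S ?R [(s, True), (s, True)] []"
      using word_equiv.relator[of "[]" S "[]" "[(s, True), (s, True)]" ?R] by simp
    then have "f ([(s, True)] @ [(s, True)]) = \<one>" 
      using f_eq[of "[(s, True), (s, True)]" "[]"] f_nil s by simp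
    then show ?thesis using s f_append[of "[(s, True)]" "[(s, True)]"] \<phi>_gen[OF s]
      by (simp add: f_def)
  qed
  then show "s \<in> S \<Longrightarrow> s \<otimes> s = \<one>" .
  \<comment> \<open>\<open>\<phi>\<close> is only prescribed on positive letters; an inverse letter is sent to the same
    generator because both are inverse to \<open>s\<close>.\<close>
  have f_letter: "f [(s, b)] = s" if s: "s \<in> S" for s b
  proof (cases b)
    case True
    then show ?thesis using \<phi>_gen[OF s] by (simp add: f_def)
  next
    case False
    have "word_equiv S ?R [(s, False), (s, True)] []"
      using word_equiv.cancel[of "[]" S "[]" s ?R False] s by simp
    then have "f [(s, False)] \<otimes> s = \<one>"
      using f_eq[of "[(s, False)] @ [(s, True)]" "[]"] f_nil s f_append[of "[(s, False)]" "[(s, True)]"]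
        \<phi>_gen[OF s] by (simp add: f_def)
    then have "f [(s, False)] \<otimes> s = s \<otimes> s" using sq s by simp
    then show ?thesis using False s f_closed[of "[(s, False)]"] by simp
  qed
  have val: "word_value W (\<lambda>s. s) u = f u" if "u \<in> group_words S" for u
    using that
  proof (induction u)
    case Nil
    then show ?case by (simp add: f_nil)
  next
    case (Cons a u)
    then show ?case using f_append[of "[a]" u] f_letter[of "fst a" "snd a"] by simp
  qed
  show "word_value W (\<lambda>s. s) u = word_value W (\<lambda>s. s) v \<longleftrightarrow> word_equiv S ?R u v"
    if "u \<in> group_words S" "v \<in> group_words S" for u v
    using that by (simp add: val f_eq)
  show "\<exists>u\<in>group_words S. word_value W (\<lambda>s. s) u = w" if w: "w \<in> carrier W" for w
  proof -
    have "w \<in> \<phi> ` word_class S ?R ` group_words S"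
      using bij w unfolding bij_betw_def carr by simp
    then show ?thesis using val by (auto simp: f_def)
  qed
qed

lemma generator_relation:
  assumes "s \<in> S" "t \<in> S" "m s t = enat n"
  shows "(s \<otimes> t) [^] n = \<one>"
proof -
  let ?r = "concat (replicate n [(s, True), (t, True)])"
  have r: "?r \<in> coxeter_relators S m"
    using assms by (auto simp: coxeter_relators_def)
  then have gw: "?r \<in> group_words S" using coxeter_relators_subset by blast
  have "word_equiv S (coxeter_relators S m) ?r []"
    using word_equiv.relator[OF _ _ r, of "[]" S "[]"] by simp
  then have "word_value W (\<lambda>s. s) ?r = \<one>"
    using word_value_eq_iff[OF gw, of "[]"] by simp
  then show ?thesis
    using word_value_alternating[OF monoid_axioms, of "\<lambda>s. s" S s t n True True] assms by simp
qed

lemma commute_of_square_one: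
  assumes "s \<in> S" "t \<in> S" "(s \<otimes> t) \<otimes> (s \<otimes> t) = \<one>"
  shows "s \<otimes> t = t \<otimes> s"
proof -
  have "(t \<otimes> s) \<otimes> (s \<otimes> t) = t \<otimes> (s \<otimes> s) \<otimes> t" using assms(1,2) by (simp add: m_assoc)
  also have "\<dots> = \<one>" using assms(1,2) by (simp add: gen_square)
  finally have "(s \<otimes> t) \<otimes> (s \<otimes> t) = (t \<otimes> s) \<otimes> (s \<otimes> t)" using assms(3) by simp
  then show ?thesis using assms(1,2) by (simp del: m_assoc)
qed

lemma generation_induct [consumes 1, case_names one step]:
  assumes "w \<in> carrier W" and "P \<one>"
    and "\<And>s w. s \<in> S \<Longrightarrow> w \<in> carrier W \<Longrightarrow> P w \<Longrightarrow> P (s \<otimes> w)"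
  shows "P w"
proof -
  obtain u where u: "u \<in> group_words S" "word_value W (\<lambda>s. s) u = w"
    using ex_word_value[OF assms(1)] by auto
  have "word_value W (\<lambda>s. s) u \<in> carrier W \<and> P (word_value W (\<lambda>s. s) u)" using u(1)
    by (induction u) (use assms in auto)
  then show ?thesis using u by simp
qed

text \<open>Von Dyck's theorem. The target is only a monoid, so that it also yields actions, with the
  monoid of self-maps of a set as target.\<close>

lemma hom_extension:
  assumes H: "monoid H" "g \<in> S \<rightarrow> carrier H"
    and rel: "\<And>s t n. s \<in> S \<Longrightarrow> t \<in> S \<Longrightarrow> m s t = enat n \<Longrightarrow> (g s \<otimes>\<^bsub>H\<^esub> g t) [^]\<^bsub>H\<^esub> n = \<one>\<^bsub>H\<^esub>"
  obtains h where "h \<in> hom W H" "h \<one> = \<one>\<^bsub>H\<^esub>" "\<And>s. s \<in> S \<Longrightarrow> h s = g s"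
proof -
  let ?val = "word_value W (\<lambda>s. s)"
  define word where "word w = (SOME u. u \<in> group_words S \<and> ?val u = w)" for w
  define h where "h w = word_value H g (word w)" for w
  have word: "word w \<in> group_words S" "?val (word w) = w" if "w \<in> carrier W" for w
    using someI_ex[of "\<lambda>u. u \<in> group_words S \<and> ?val u = w"] ex_word_value[OF that]
    unfolding word_def by auto
  have val: "?val u \<in> carrier W" if "u \<in> group_words S" for u
    using word_value_closed[OF monoid_axioms _ that] S_carrier by auto
  have h: "h (?val u) = word_value H g u" if u: "u \<in> group_words S" for u
    unfolding h_def
  proof (rule word_equiv_word_value[OF _ label_diag H rel])
    show "word_equiv S (coxeter_relators S m) (word (?val u)) u"
      using word[OF val[OF u]] u by (simp flip: word_value_eq_iff)
  qed
  show thesis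
  proof (rule that)
    show "h \<in> hom W H"
    proof (rule homI)
      fix x y assume xy: "x \<in> carrier W" "y \<in> carrier W"
      show "h x \<in> carrier H"
        unfolding h_def using word xy by (intro word_value_closed[OF H]) auto
      have "x \<otimes> y = ?val (word x @ word y)"
        using word_value_append[OF monoid_axioms _ word(1)[OF xy(1)] word(1)[OF xy(2)], of "\<lambda>s. s"]
          word xy by simp
      then show "h (x \<otimes> y) = h x \<otimes>\<^bsub>H\<^esub> h y"
        using h[of "word x @ word y"] word xy by (simp add: word_value_append[OF H] h_def)
    qed
    show "h \<one> = \<one>\<^bsub>H\<^esub>" using h[of "[]"] by simp
    show "h s = g s" if "s \<in> S" for s
    proof -
      have "g s \<in> carrier H" using H that by auto
      then show ?thesis using h[of "[(s, True)]"] that H(1) by (simp add: monoid.r_one)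
    qed
  qed
qed

end

section \<open>Coxeter systems in which finite labels mean commutation\<close>

text \<open>A form of right-angledness that does not ask what the finite labels are. It can be checked for
  a generating set of which only the group structure is known, and it makes the commutation relation
  of \<open>W\<close> on \<open>S\<close> the only data that matters.\<close>

locale commuting_coxeter = coxeter +
  assumes finite_label_commute: "s \<in> S \<Longrightarrow> t \<in> S \<Longrightarrow> m s t \<noteq> \<infinity> \<Longrightarrow> s \<otimes> t = t \<otimes> s"
begin

lemma gen_cancel [simp]: "s \<in> S \<Longrightarrow> x \<in> carrier W \<Longrightarrow> s \<otimes> (s \<otimes> x) = x"
  "s \<in> S \<Longrightarrow> x \<in> carrier W \<Longrightarrow> x \<otimes> s \<otimes> s = x"
  by (simp add: gen_square flip: m_assoc) (simp add: gen_square m_assoc)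

text \<open>Distinct commuting generators have a product of order exactly 2, so the exponent of a relation
  between them is even, and the relation is a consequence of commutation. This replaces the theorem
  that \<open>m s t\<close> is the order of \<open>s \<otimes> t\<close>.\<close>

lemma finite_label_even:
  assumes "s \<in> S" "t \<in> S" "s \<noteq> t" "m s t = enat n"
  shows "even n"
proof (rule ccontr)
  assume "odd n"
  then obtain k where k: "n = 2 * k + 1" by (auto elim: oddE)
  have comm: "s \<otimes> t = t \<otimes> s" using finite_label_commute[of s t] assms by simp
  have sq: "(s \<otimes> t) [^] (2::nat) = \<one>"
    using assms comm by (simp add: pow_mult_distrib) (simp add: numeral_2_eq_2 gen_square)
  have "\<one> = (s \<otimes> t) [^] n" using generator_relation assms by simp
  also have "\<dots> = ((s \<otimes> t) [^] (2::nat)) [^] k \<otimes> (s \<otimes> t)"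
    using assms unfolding k by (simp add: nat_pow_mult[symmetric] nat_pow_pow)
  also have "\<dots> = s \<otimes> t" using assms sq by simp
  finally have "s \<otimes> s = s \<otimes> t" using assms gen_square by simp
  then show False using assms by simp
qed

lemma involution_hom_extension:
  assumes H: "monoid H" "g \<in> S \<rightarrow> carrier H"
    and sq: "\<And>s. s \<in> S \<Longrightarrow> g s \<otimes>\<^bsub>H\<^esub> g s = \<one>\<^bsub>H\<^esub>"
    and comm: "\<And>s t. s \<in> S \<Longrightarrow> t \<in> S \<Longrightarrow> s \<otimes> t = t \<otimes> s \<Longrightarrow> g s \<otimes>\<^bsub>H\<^esub> g t = g t \<otimes>\<^bsub>H\<^esub> g s"
  obtains h where "h \<in> hom W H" "h \<one> = \<one>\<^bsub>H\<^esub>" "\<And>s. s \<in> S \<Longrightarrow> h s = g s"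
proof (rule hom_extension[OF H])
  interpret H: monoid H by fact
  fix s t n assume st: "s \<in> S" "t \<in> S" "m s t = enat n"
  have [simp]: "g s \<in> carrier H" "g t \<in> carrier H" using H st by auto
  show "(g s \<otimes>\<^bsub>H\<^esub> g t) [^]\<^bsub>H\<^esub> n = \<one>\<^bsub>H\<^esub>"
  proof (cases "s = t")
    case True
    then show ?thesis using sq st by (simp add: H.nat_pow_one)
  next
    case False
    obtain k where k: "n = 2 * k" using finite_label_even[OF st(1,2) False st(3)] by auto
    have "g s \<otimes>\<^bsub>H\<^esub> g t = g t \<otimes>\<^bsub>H\<^esub> g s"
      using comm[of s t] finite_label_commute[of s t] st by simp
    then have "(g s \<otimes>\<^bsub>H\<^esub> g t) [^]\<^bsub>H\<^esub> (2::nat) = \<one>\<^bsub>H\<^esub>"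
      using sq st by (simp add: H.pow_mult_distrib) (simp add: numeral_2_eq_2)
    then show ?thesis unfolding k by (simp add: H.nat_pow_one flip: H.nat_pow_pow)
  qed
qed (rule that)

text \<open>A homomorphism into the monoid of self-maps is an action. All representations below are
  obtained in this way.\<close>

lemma action_extension:
  fixes F :: "'a \<Rightarrow> 'x \<Rightarrow> 'x"
  assumes sq: "\<And>s x. s \<in> S \<Longrightarrow> F s (F s x) = x"
    and comm: "\<And>s t x. s \<in> S \<Longrightarrow> t \<in> S \<Longrightarrow> s \<otimes> t = t \<otimes> s \<Longrightarrow> F s (F t x) = F t (F s x)"
  obtains \<rho> where "\<And>x y p. x \<in> carrier W \<Longrightarrow> y \<in> carrier W \<Longrightarrow> \<rho> (x \<otimes> y) p = \<rho> x (\<rho> y p)"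
    "\<And>p. \<rho> \<one> p = p" "\<And>s. s \<in> S \<Longrightarrow> \<rho> s = F s"
proof -
  define H :: "('x \<Rightarrow> 'x) monoid" where "H = \<lparr>carrier = UNIV, mult = (\<circ>), one = id\<rparr>"
  have "monoid H" by (rule monoidI) (auto simp: H_def)
  moreover have "F \<in> S \<rightarrow> carrier H" by (simp add: H_def)
  ultimately obtain h where "h \<in> hom W H" "h \<one> = \<one>\<^bsub>H\<^esub>" "\<And>s. s \<in> S \<Longrightarrow> h s = F s"
    by (rule involution_hom_extension) (auto simp: H_def fun_eq_iff sq comm)
  then show thesis by (intro that[of h]) (auto simp: H_def hom_def)
qed

end

section \<open>Integral transformations of finite order\<close>

text \<open>With \<open>h = 1 + N\<close> and \<open>N\<close> divisible by \<open>d\<close>, this is \<open>h\<^sup>j = 1 + j N\<close> modulo \<open>d\<^sup>2\<close>, the beginning of the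
  binomial expansion.\<close>

lemma funpow_expansion_mod_square:
  fixes h :: "('a \<Rightarrow> int) \<Rightarrow> ('a \<Rightarrow> int)"
  assumes add: "\<And>f g x. h (\<lambda>y. f y + g y) x = h f x + h g x"
    and scale: "\<And>c f x. h (\<lambda>y. c * f y) x = c * h f x"
    and cong: "\<And>f x. d dvd h f x - f x"
  shows "d * d dvd (h ^^ j) f x - f x - int j * (h f x - f x)"
proof (induction j arbitrary: x)
  case 0
  then show ?case by simp
next
  case (Suc j)
  have "d dvd (h ^^ j) f y - f y" for y
  proof -
    have "d dvd (h ^^ j) f y - f y - int j * (h f y - f y)" using Suc[of y] by (rule dvd_mult_left)
    moreover have "d dvd int j * (h f y - f y)" using cong by simp
    ultimately show ?thesis by (metis dvd_add diff_add_cancel)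
  qed
  then have "\<exists>z. (h ^^ j) f y = f y + d * z" for y
    by (metis dvd_def diff_eq_eq add.commute)
  then obtain g where g: "\<And>y. (h ^^ j) f y = f y + d * g y" by metis
  then have "(h ^^ j) f = (\<lambda>y. f y + d * g y)" by (simp add: fun_eq_iff)
  then have "(h ^^ Suc j) f x = h f x + d * h g x" by (simp add: add scale)
  then have "(h ^^ Suc j) f x - f x - int (Suc j) * (h f x - f x)
      = d * (h g x - g x) + ((h ^^ j) f x - f x - int j * (h f x - f x))"
    by (simp add: g algebra_simps)
  moreover have "d * d dvd d * (h g x - g x)" using cong by simp
  ultimately show ?case using Suc[of x] by (metis dvd_add)
qed

text \<open>If \<open>N = h - 1\<close> is divisible by \<open>d = 2\<^sup>k\<close> with \<open>k \<ge> 2\<close>, then \<open>h\<^sup>n = 1\<close> makes \<open>n N\<close> divisible by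
  \<open>d\<^sup>2\<close>. For odd \<open>n\<close>, and also for \<open>n = 2\<close> as \<open>2 k - 1 > k\<close>, this makes \<open>N\<close> divisible by
  a higher power of 2 than before. So \<open>N\<close> is divisible by all powers of 2 and vanishes.\<close>

lemma odd_or_two_order_eq_id:
  fixes h :: "('a \<Rightarrow> int) \<Rightarrow> ('a \<Rightarrow> int)"
  assumes add: "\<And>f g x. h (\<lambda>y. f y + g y) x = h f x + h g x"
    and scale: "\<And>c f x. h (\<lambda>y. c * f y) x = c * h f x"
    and cong: "\<And>f x. 4 dvd h f x - f x"
    and n: "odd n \<or> n = 2" and order: "\<And>f. (h ^^ n) f = f"
  shows "h f = f"
proof
  fix x
  have div: "2 ^ (k + 2) dvd h f x - f x" for k f x
  proof (induction k arbitrary: f x)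
    case 0
    then show ?case using cong by simp
  next
    case (Suc k)
    let ?d = "2 ^ (k + 2) :: int"
    have "?d * ?d dvd (h ^^ n) f x - f x - int n * (h f x - f x)"
      by (rule funpow_expansion_mod_square[of h]) (rule add scale Suc)+
    then have *: "?d * ?d dvd int n * (h f x - f x)" by (simp add: order)
    have dd: "?d * ?d = 2 * (2 ^ (Suc k + 2) * 2 ^ k)" by (simp add: power_add)
    show ?case
    proof (cases "n = 2")
      case True
      with * have "2 * (2 ^ (Suc k + 2) * 2 ^ k) dvd 2 * (h f x - f x)" unfolding dd by simp
      then have "2 ^ (Suc k + 2) * 2 ^ k dvd h f x - f x" by (simp only: dvd_mult_cancel_left) simp
      then show ?thesis by (rule dvd_mult_left)
    next
      case False
      with n have "coprime 2 (int n)" by simp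
      then have "coprime (?d * ?d) (int n)"
        by (simp only: coprime_mult_left_iff coprime_power_left_iff) simp
      then have "?d * ?d dvd h f x - f x" using * by (simp only: coprime_dvd_mult_right_iff)
      then have "2 ^ (Suc k + 2) * (2 * 2 ^ k) dvd h f x - f x"
        unfolding dd by (simp only: ac_simps)
      then show ?thesis by (rule dvd_mult_left)
    qed
  qed
  show "h f x = f x"
  proof (rule ccontr)
    assume ne: "h f x \<noteq> f x"
    define k where "k = nat \<bar>h f x - f x\<bar>"
    have "\<bar>2 ^ (k + 2) :: int\<bar> \<le> \<bar>h f x - f x\<bar>" using div[of k f x] ne by (intro dvd_imp_le_int) auto
    then have "2 ^ (k + 2) \<le> int k" by (simp add: k_def)
    moreover have "k < 2 ^ k" by (rule less_exp)
    then have "int k < 2 ^ k" by (metis of_nat_less_iff of_nat_power of_nat_numeral)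
    moreover have "(2::int) ^ k \<le> 2 ^ (k + 2)" by (simp add: power_increasing)
    ultimately show False by linarith
  qed
qed

text \<open>Minkowski's lemma at the modulus 4. An even order \<open>2 k\<close> is halved by applying the case of
  order 2 to the \<open>k\<close>-th power.\<close>

lemma finite_order_eq_id:
  fixes h :: "('a \<Rightarrow> int) \<Rightarrow> ('a \<Rightarrow> int)"
  assumes "\<And>f g x. h (\<lambda>y. f y + g y) x = h f x + h g x"
    and "\<And>c f x. h (\<lambda>y. c * f y) x = c * h f x"
    and "\<And>f x. 4 dvd h f x - f x"
    and "n > 0" and "\<And>f. (h ^^ n) f = f"
  shows "h f = f"
  using assms(4,5)
proof (induction n arbitrary: f rule: less_induct)
  case (less n)
  note h = assms(1-3)
  show ?case
  proof (cases "odd n")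
    case True
    then show ?thesis using odd_or_two_order_eq_id[OF h _ less.prems(2)] by blast
  next
    case False
    then obtain k where k: "n = k + k" by (metis evenE mult_2)
    have "(h ^^ k) f = f" for f
    proof (rule odd_or_two_order_eq_id[of _ 2])
      show "(h ^^ k) (\<lambda>y. f y + g y) x = (h ^^ k) f x + (h ^^ k) g x" for f g x
      proof (induction k arbitrary: x)
        case (Suc k)
        then have "(h ^^ k) (\<lambda>y. f y + g y) = (\<lambda>y. (h ^^ k) f y + (h ^^ k) g y)"
          by (simp add: fun_eq_iff)
        then show ?case by (simp add: h(1))
      qed simp
      show "(h ^^ k) (\<lambda>y. c * f y) x = c * (h ^^ k) f x" for c f x
      proof (induction k arbitrary: x)
        case (Suc k)
        then have "(h ^^ k) (\<lambda>y. c * f y) = (\<lambda>y. c * (h ^^ k) f y)" by (simp add: fun_eq_iff)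
        then show ?case by (simp add: h(2))
      qed simp
      show "4 dvd (h ^^ k) f x - f x" for f x
      proof (induction k)
        case (Suc k)
        have "4 dvd (h ((h ^^ k) f) x - (h ^^ k) f x) + ((h ^^ k) f x - f x)"
          using h(3) Suc by (rule dvd_add)
        then show ?case by simp
      qed simp
      show "((h ^^ k) ^^ 2) f = f" for f
        using less.prems(2)[of f] by (simp add: k funpow_add numeral_2_eq_2)
    qed simp
    then show ?thesis using less.IH[of k] less.prems(1) k by simp
  qed
qed

section \<open>The geometric representation is faithful\<close>

context commuting_coxeter
begin

definition word_length :: "'a \<Rightarrow> nat" where
  "word_length w = (LEAST n. \<exists>u\<in>group_words S. word_value W (\<lambda>s. s) u = w \<and> length u = n)"

lemma reduced_word:
  assumes "w \<in> carrier W"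
  obtains u where "u \<in> group_words S" "word_value W (\<lambda>s. s) u = w" "length u = word_length w"
proof -
  have "\<exists>n. \<exists>u\<in>group_words S. word_value W (\<lambda>s. s) u = w \<and> length u = n"
    using ex_word_value[OF assms] by auto
  from LeastI_ex[OF this] show thesis using that unfolding word_length_def by auto
qed

lemma word_length_le:
  assumes "u \<in> group_words S" "word_value W (\<lambda>s. s) u = w"
  shows "word_length w \<le> length u"
  unfolding word_length_def using assms by (intro Least_le) auto

lemma word_value_gens_append:
  assumes "u \<in> group_words S" "v \<in> group_words S"
  shows "word_value W (\<lambda>s. s) (u @ v) = word_value W (\<lambda>s. s) u \<otimes> word_value W (\<lambda>s. s) v"
  using word_value_append[OF monoid_axioms _ assms, of "\<lambda>s. s"] by auto

lemma word_length_mult_gen_le: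
  assumes "w \<in> carrier W" "s \<in> S"
  shows "word_length (w \<otimes> s) \<le> Suc (word_length w)"
proof -
  obtain u where "u \<in> group_words S" "word_value W (\<lambda>s. s) u = w" "length u = word_length w"
    using reduced_word assms by blast
  then show ?thesis
    using word_length_le[of "u @ [(s, True)]" "w \<otimes> s"] assms
      word_value_gens_append[of u "[(s, True)]"] by simp
qed

lemma ex_right_descent:
  assumes "w \<in> carrier W" "w \<noteq> \<one>"
  obtains s where "s \<in> S" "word_length (w \<otimes> s) < word_length w"
proof -
  obtain u where u: "u \<in> group_words S" "word_value W (\<lambda>s. s) u = w" "length u = word_length w"
    using reduced_word assms by blast
  with assms have "u \<noteq> []" by auto
  then obtain u' a where ua: "u = u' @ [a]" by (metis rev_exhaust)
  have u': "u' \<in> group_words S" "fst a \<in> S" using u ua by auto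
  then have v: "word_value W (\<lambda>s. s) u' \<in> carrier W"
    using word_value_closed[OF monoid_axioms _ u'(1)] by auto
  have "w = word_value W (\<lambda>s. s) u' \<otimes> fst a"
    using u(2) u' word_value_gens_append[of u' "[a]"] unfolding ua by simp
  then have "w \<otimes> fst a = word_value W (\<lambda>s. s) u'" using u' v by simp
  then have "word_length (w \<otimes> fst a) \<le> length u'" using word_length_le u' by metis
  then show thesis using that[of "fst a"] u' u(3) ua by simp
qed

definition noncommuting :: "'a \<Rightarrow> 'a set" where
  "noncommuting s = {t \<in> S. s \<otimes> t \<noteq> t \<otimes> s}"

text \<open>A function \<open>f\<close> stands for the vector \<open>\<Sum>\<^sub>t f(t) \<alpha>\<^sub>t\<close>. On the span of the simple roots
  \<open>\<alpha>\<^sub>t\<close>, this is the reflection in \<open>\<alpha>\<^sub>s\<close> for the bilinear form with \<open>B(\<alpha>\<^sub>s,\<alpha>\<^sub>s) = 1\<close>, and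
  \<open>B(\<alpha>\<^sub>s,\<alpha>\<^sub>t) = 0\<close> or \<open>-1\<close> according to whether \<open>s\<close> and \<open>t\<close> commute.\<close>

definition reflection :: "'a \<Rightarrow> ('a \<Rightarrow> int) \<Rightarrow> 'a \<Rightarrow> int" where
  "reflection s f = f(s := - f s + 2 * sum f (noncommuting s))"

definition simple_root :: "'a \<Rightarrow> 'a \<Rightarrow> int" where
  "simple_root s x = (if x = s then 1 else 0)"

lemma finite_noncommuting [simp]: "finite (noncommuting s)"
  using finite_S by (simp add: noncommuting_def)

lemma reflection_involution: "reflection s (reflection s f) = f"
proof -
  have "s \<notin> noncommuting s" by (simp add: noncommuting_def)
  then have "sum (f(s := c)) (noncommuting s) = sum f (noncommuting s)" for c
    by (intro sum.cong) auto
  then show ?thesis by (simp add: reflection_def)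
qed

lemma reflection_commute:
  assumes "s \<in> S" "t \<in> S" "s \<otimes> t = t \<otimes> s"
  shows "reflection s (reflection t f) = reflection t (reflection s f)"
proof (cases "s = t")
  case False
  have "s \<notin> noncommuting t" "t \<notin> noncommuting s" using assms by (auto simp: noncommuting_def)
  then have "sum (f(s := c)) (noncommuting t) = sum f (noncommuting t)"
    "sum (f(t := c)) (noncommuting s) = sum f (noncommuting s)" for c
    by (intro sum.cong; force)+
  then show ?thesis using False by (simp add: reflection_def fun_upd_twist)
qed simp

definition geometric_action :: "('a \<Rightarrow> ('a \<Rightarrow> int) \<Rightarrow> 'a \<Rightarrow> int) \<Rightarrow> bool" where
  "geometric_action \<rho> \<longleftrightarrow>
     (\<forall>x\<in>carrier W. \<forall>y\<in>carrier W. \<forall>f. \<rho> (x \<otimes> y) f = \<rho> x (\<rho> y f)) \<and>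
     (\<forall>f. \<rho> \<one> f = f) \<and> (\<forall>s\<in>S. \<rho> s = reflection s)"

lemma ex_geometric_action: "\<exists>\<rho>. geometric_action \<rho>"
proof (rule action_extension[of reflection, OF reflection_involution reflection_commute])
  fix \<rho> :: "'a \<Rightarrow> ('a \<Rightarrow> int) \<Rightarrow> 'a \<Rightarrow> int"
  assume "\<And>x y f. x \<in> carrier W \<Longrightarrow> y \<in> carrier W \<Longrightarrow> \<rho> (x \<otimes> y) f = \<rho> x (\<rho> y f)"
    "\<And>f. \<rho> \<one> f = f" "\<And>s. s \<in> S \<Longrightarrow> \<rho> s = reflection s"
  then show ?thesis by (intro exI[of _ \<rho>]) (simp add: geometric_action_def)
qed

context
  fixes \<rho> assumes \<rho>: "geometric_action \<rho>"
begin

lemma action_mult: "x \<in> carrier W \<Longrightarrow> y \<in> carrier W \<Longrightarrow> \<rho> (x \<otimes> y) f = \<rho> x (\<rho> y f)"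
  and action_one: "\<rho> \<one> f = f"
  and action_gen: "s \<in> S \<Longrightarrow> \<rho> s = reflection s"
  using \<rho> by (auto simp: geometric_action_def)

lemma action_add:
  assumes "w \<in> carrier W"
  shows "\<rho> w (\<lambda>y. f y + g y) = (\<lambda>y. \<rho> w f y + \<rho> w g y)"
  using assms
  by (induction w rule: generation_induct)
     (auto simp: action_one action_mult action_gen reflection_def fun_eq_iff sum.distrib algebra_simps)

lemma action_scale:
  assumes "w \<in> carrier W"
  shows "\<rho> w (\<lambda>y. c * f y) = (\<lambda>y. c * \<rho> w f y)"
  using assms
  by (induction w rule: generation_induct)
     (auto simp: action_one action_mult action_gen reflection_def fun_eq_iff algebra_simps
        simp flip: sum_distrib_left)

text \<open>The off-diagonal entries of a reflection are 0 or 2, and the diagonal ones are 1 or -1.\<close>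

lemma action_cong_2:
  assumes "w \<in> carrier W"
  shows "even (\<rho> w f x - f x)"
  using assms
proof (induction w arbitrary: x rule: generation_induct)
  case (step s w)
  then show ?case by (cases "x = s") (auto simp: action_mult action_gen reflection_def)
qed (simp add: action_one)

lemma reflection_root_combination:
  assumes "s \<in> S" "t \<in> S" "s \<otimes> t \<noteq> t \<otimes> s"
  shows "reflection t (\<lambda>x. p * simple_root s x + q * simple_root t x)
    = (\<lambda>x. p * simple_root s x + (2 * p - q) * simple_root t x)"
proof -
  have "s \<noteq> t" using assms by auto
  moreover have "s \<in> noncommuting t" "t \<notin> noncommuting t"
    using assms by (auto simp: noncommuting_def)
  ultimately have "(\<Sum>x\<in>noncommuting t. p * simple_root s x + q * simple_root t x) = p"
    by (simp add: simple_root_def sum.distrib if_distrib[of "(*) _"] cong: if_cong)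
  then show ?thesis using \<open>s \<noteq> t\<close> by (auto simp: reflection_def simple_root_def fun_eq_iff)
qed

lemma reflection_root_commuting:
  assumes "s \<in> S" "t \<in> S" "s \<noteq> t" "s \<otimes> t = t \<otimes> s"
  shows "reflection t (simple_root s) = simple_root s"
proof -
  have "s \<notin> noncommuting t" using assms by (auto simp: noncommuting_def)
  then have "sum (simple_root s) (noncommuting t) = 0"
    by (auto simp: simple_root_def intro!: sum.neutral)
  then show ?thesis using assms by (auto simp: reflection_def simple_root_def fun_eq_iff)
qed

lemma reflection_root_self: "reflection s (simple_root s) = (\<lambda>x. - 1 * simple_root s x)"
proof -
  have "sum (simple_root s) (noncommuting s) = 0"
    by (auto simp: simple_root_def noncommuting_def intro!: sum.neutral)
  then show ?thesis by (auto simp: reflection_def simple_root_def fun_eq_iff)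
qed

text \<open>The first conjunct is the positivity theorem for roots. For \<open>w \<noteq> 1\<close>, write \<open>w = v t\<close> with \<open>v\<close>
  shorter; then \<open>t \<noteq> s\<close>, and one argues by induction on the length.
  If \<open>s\<close> and \<open>t\<close> commute, \<open>t\<close> fixes \<open>\<alpha>\<^sub>s\<close> and \<open>v\<close> is handled by induction. Otherwise
  \<open>t\<close> sends \<open>\<alpha>\<^sub>s\<close> to \<open>\<alpha>\<^sub>s + 2 \<alpha>\<^sub>t\<close>, which is why the second conjunct is proved simultaneously:
  the vectors \<open>p \<alpha>\<^sub>s + q \<alpha>\<^sub>t\<close> with \<open>0 \<le> p \<le> q\<close> are mapped by \<open>s\<close> to vectors of the same
  shape with the roles of \<open>s\<close> and \<open>t\<close> exchanged. So one can strip letters \<open>s\<close> and \<open>t\<close> in turn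
  from the right end of \<open>w\<close> until neither shortens it.\<close>

lemma ascending_roots_nonneg:
  assumes "w \<in> carrier W"
  shows "(\<forall>s\<in>S. word_length w \<le> word_length (w \<otimes> s) \<longrightarrow> (\<forall>x. 0 \<le> \<rho> w (simple_root s) x)) \<and>
    (\<forall>s\<in>S. \<forall>t\<in>S. \<forall>p q. s \<otimes> t \<noteq> t \<otimes> s \<longrightarrow> word_length w \<le> word_length (w \<otimes> t) \<longrightarrow>
      0 \<le> p \<longrightarrow> p \<le> q \<longrightarrow>
      (\<forall>x. 0 \<le> \<rho> w (\<lambda>y. p * simple_root s y + q * simple_root t y) x))"
    (is "?A w \<and> ?B w")
  using assms
proof (induction w rule: measure_induct_rule[of word_length])
  case (less w)
  have IH: "?A v" "?B v" if "v \<in> carrier W" "word_length v < word_length w" for v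
    using less.IH[OF that(2,1)] by blast+
  have A: "?A w"
  proof (intro ballI impI allI)
    fix s x assume s: "s \<in> S" and asc: "word_length w \<le> word_length (w \<otimes> s)"
    show "0 \<le> \<rho> w (simple_root s) x"
    proof (cases "w = \<one>")
      case True
      then show ?thesis by (simp add: action_one simple_root_def)
    next
      case False
      obtain t where t: "t \<in> S" "word_length (w \<otimes> t) < word_length w"
        using ex_right_descent[OF less.prems False] by blast
      define v where "v = w \<otimes> t"
      have v: "v \<in> carrier W" "w = v \<otimes> t" "word_length v < word_length w"
        using t less.prems by (auto simp: v_def)
      have st: "s \<noteq> t" using t asc by auto
      have wv: "\<rho> w f = \<rho> v (reflection t f)" for f
        using v(1) t by (simp add: v(2) action_mult action_gen)
      show ?thesis
      proof (cases "s \<otimes> t = t \<otimes> s")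
        case True
        \<comment> \<open>If \<open>v \<otimes> s\<close> were shorter than \<open>v\<close>, then \<open>w \<otimes> s\<close> would be shorter than \<open>w\<close>.\<close>
        have "w \<otimes> s = v \<otimes> s \<otimes> t" using v(1) s t True by (simp add: v(2) m_assoc)
        then have "word_length (w \<otimes> s) \<le> Suc (word_length (v \<otimes> s))"
          using word_length_mult_gen_le v s t by simp
        then have "word_length v \<le> word_length (v \<otimes> s)"
          using asc v by linarith
        then show ?thesis
          using IH(1)[OF v(1,3)] s t st True by (simp add: wv reflection_root_commuting)
      next
        case False
        have "simple_root s = (\<lambda>x. 1 * simple_root s x + 0 * simple_root t x)" by simp
        then have "\<rho> w (simple_root s) = \<rho> v (\<lambda>x. 1 * simple_root s x + 2 * simple_root t x)"
          using reflection_root_combination[OF s t(1) False, of 1 0] by (simp add: wv)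
        moreover have "word_length v \<le> word_length (v \<otimes> t)" using v by simp
        moreover have "0 \<le> \<rho> v (\<lambda>x. 1 * simple_root s x + 2 * simple_root t x) x"
          if "word_length v \<le> word_length (v \<otimes> t)"
          using IH(2)[OF v(1,3), rule_format, OF s t(1) False that, of 1 2 x] by simp
        ultimately show ?thesis by simp
      qed
    qed
  qed
  have "?B w"
  proof (intro ballI impI allI)
    fix s t p q x
    assume s: "s \<in> S" and t: "t \<in> S" and st: "s \<otimes> t \<noteq> t \<otimes> s"
      and asc: "word_length w \<le> word_length (w \<otimes> t)" and pq: "0 \<le> p" "p \<le> (q::int)"
    show "0 \<le> \<rho> w (\<lambda>y. p * simple_root s y + q * simple_root t y) x"
    proof (cases "word_length w \<le> word_length (w \<otimes> s)")
      case True
      then have "0 \<le> \<rho> w (simple_root s) x" "0 \<le> \<rho> w (simple_root t) x"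
        using A s t asc by auto
      then show ?thesis
        using pq less.prems by (simp add: action_add action_scale)
    next
      case False
      define v where "v = w \<otimes> s"
      have v: "v \<in> carrier W" "w = v \<otimes> s" "word_length v < word_length w"
        using s less.prems False by (auto simp: v_def)
      have "\<rho> w (\<lambda>y. p * simple_root s y + q * simple_root t y)
        = \<rho> v (\<lambda>y. q * simple_root t y + (2 * q - p) * simple_root s y)"
        using reflection_root_combination[OF t s, of q p] v(1) s st
        by (simp add: v(2) action_mult action_gen add.commute)
      moreover have "word_length v \<le> word_length (v \<otimes> s)" using v by simp
      moreover have "0 \<le> \<rho> v (\<lambda>y. q * simple_root t y + (2 * q - p) * simple_root s y) x"
        if "word_length v \<le> word_length (v \<otimes> s)"
        using IH(2)[OF v(1,3), rule_format, OF t s st[symmetric] that, of q "2 * q - p" x] pq by simp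
      ultimately show ?thesis by simp
    qed
  qed
  with A show ?case by blast
qed

text \<open>An element \<open>w \<noteq> 1\<close> can be shortened by some \<open>s\<close> on the right. Then \<open>w s\<close> keeps \<open>\<alpha>\<^sub>s\<close>
  nonnegative, so \<open>w\<close> makes it nonpositive and does not act as the identity.\<close>

lemma action_faithful:
  assumes w: "w \<in> carrier W" and trivial: "\<And>f. \<rho> w f = f"
  shows "w = \<one>"
proof (rule ccontr)
  assume "w \<noteq> \<one>"
  then obtain s where s: "s \<in> S" "word_length (w \<otimes> s) < word_length w"
    using ex_right_descent w by blast
  have "word_length (w \<otimes> s) \<le> word_length (w \<otimes> s \<otimes> s)" using s w by simp
  then have "0 \<le> \<rho> (w \<otimes> s) (simple_root s) s"
    using ascending_roots_nonneg[of "w \<otimes> s"] s w by auto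
  also have "\<rho> (w \<otimes> s) (simple_root s) = \<rho> w (\<lambda>x. - 1 * simple_root s x)"
    using s w by (simp add: action_mult action_gen reflection_root_self)
  finally show False by (simp add: trivial simple_root_def)
qed

lemma action_nat_pow:
  assumes "w \<in> carrier W"
  shows "\<rho> (w [^] (n::nat)) f = (\<rho> w ^^ n) f"
  by (induction n arbitrary: f) (use assms in \<open>simp_all add: action_one action_mult funpow_swap1\<close>)

end

text \<open>A square of an element that is trivial modulo 2 is trivial modulo 4: from \<open>w = 1 + 2 g\<close> follows
  \<open>w\<^sup>2 = 1 + 4 (g + g\<^sup>2)\<close>.\<close>

theorem torsion_square:
  assumes w: "w \<in> carrier W" and n: "n > 0" "w [^] (n::nat) = \<one>"
  shows "w \<otimes> w = \<one>"
proof -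
  obtain \<rho> where \<rho>: "geometric_action \<rho>" using ex_geometric_action by blast
  note act = action_mult[OF \<rho>] and add = action_add[OF \<rho> w] and scale = action_scale[OF \<rho> w]
  let ?h = "\<lambda>f. \<rho> w (\<rho> w f)"
  have "?h f = f" for f
  proof (rule finite_order_eq_id[of ?h n])
    show "4 dvd ?h f x - f x" for f x
    proof -
      have "\<exists>z. \<rho> w f y = f y + 2 * z" for y
        using action_cong_2[OF \<rho> w, of f y] by (metis evenE diff_eq_eq add.commute)
      then obtain g where g: "\<And>y. \<rho> w f y = f y + 2 * g y" by metis
      then have "?h f = \<rho> w (\<lambda>y. f y + 2 * g y)" by (metis (no_types, lifting) ext)
      then have "?h f x = f x + 2 * g x + 2 * \<rho> w g x" by (simp add: add scale g)
      then have "?h f x - f x = 4 * g x + 2 * (\<rho> w g x - g x)" by simp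
      moreover have "2 * 2 dvd 2 * (\<rho> w g x - g x)"
        using action_cong_2[OF \<rho> w, of g x] by (intro mult_dvd_mono) auto
      then have "4 dvd 4 * g x + 2 * (\<rho> w g x - g x)" by (intro dvd_add) simp_all
      ultimately show ?thesis by simp
    qed
    show "(?h ^^ n) f = f" for f
    proof -
      have "?h = \<rho> (w [^] (2::nat))" using w by (auto simp: numeral_2_eq_2 act)
      then have "(?h ^^ n) f = \<rho> ((w [^] (2::nat)) [^] n) f"
        using w by (simp add: action_nat_pow[OF \<rho>])
      also have "(w [^] (2::nat)) [^] n = (w [^] n) [^] (2::nat)"
        using w by (simp add: nat_pow_pow mult.commute)
      finally show ?thesis by (simp add: n action_one[OF \<rho>])
    qed
  qed (use n in \<open>simp_all add: add scale\<close>)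
  then show ?thesis using action_faithful[OF \<rho>, of "w \<otimes> w"] w by (simp add: act)
qed

end

section \<open>Supports of involutions\<close>

definition symdiff :: "'a set \<Rightarrow> 'a set \<Rightarrow> 'a set" where
  "symdiff X Y = (X - Y) \<union> (Y - X)"

lemma in_symdiff [simp]: "x \<in> symdiff X Y \<longleftrightarrow> (x \<in> X) \<noteq> (x \<in> Y)"
  by (auto simp: symdiff_def)

text \<open>Cliques; \<open>E\<close> is meant to be reflexive, like commutation.\<close>

definition pairwise_related :: "('a \<Rightarrow> 'a \<Rightarrow> bool) \<Rightarrow> 'a set \<Rightarrow> bool" where
  "pairwise_related E X \<longleftrightarrow> (\<forall>a\<in>X. \<forall>b\<in>X. E a b)"

context commuting_coxeter
begin

text \<open>The image in the abelianisation \<open>\<F>\<^sub>2\<^bsup>S\<^esup>\<close>, whose vectors are written as subsets of \<open>S\<close>.\<close>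

definition support :: "'a \<Rightarrow> 'a set" where
  "support = (SOME p. p \<one> = {} \<and> (\<forall>s\<in>S. p s = {s}) \<and>
     (\<forall>x\<in>carrier W. \<forall>y\<in>carrier W. p (x \<otimes> y) = symdiff (p x) (p y)))"

lemma support_one: "support \<one> = {}"
  and support_gen: "s \<in> S \<Longrightarrow> support s = {s}"
  and support_mult:
    "x \<in> carrier W \<Longrightarrow> y \<in> carrier W \<Longrightarrow> support (x \<otimes> y) = symdiff (support x) (support y)"
proof -
  define H :: "'a set monoid" where "H = \<lparr>carrier = UNIV, mult = symdiff, one = {}\<rparr>"
  have "monoid H" by (rule monoidI) (auto simp: H_def)
  moreover have "(\<lambda>s. {s}) \<in> S \<rightarrow> carrier H" by (simp add: H_def)
  ultimately obtain h where "h \<in> hom W H" "h \<one> = \<one>\<^bsub>H\<^esub>" "\<And>s. s \<in> S \<Longrightarrow> h s = {s}"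
    by (rule involution_hom_extension) (auto simp: H_def)
  then have "\<exists>p. p \<one> = {} \<and> (\<forall>s\<in>S. p s = {s}) \<and>
     (\<forall>x\<in>carrier W. \<forall>y\<in>carrier W. p (x \<otimes> y) = symdiff (p x) (p y))"
    by (intro exI[of _ h]) (auto simp: H_def hom_def)
  from someI_ex[OF this]
  show "support \<one> = {}" "s \<in> S \<Longrightarrow> support s = {s}"
    "x \<in> carrier W \<Longrightarrow> y \<in> carrier W \<Longrightarrow> support (x \<otimes> y) = symdiff (support x) (support y)"
    unfolding support_def by blast+
qed

lemma support_subset: "w \<in> carrier W \<Longrightarrow> support w \<subseteq> S"
  by (induction w rule: generation_induct) (auto simp: support_one support_mult support_gen)

text \<open>The support is the universal homomorphism to an elementary abelian 2-group. This makes
  equality of supports a property of the group, independent of the generating set.\<close>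

lemma hom_determined_by_support:
  assumes q: "q \<one> = {}" "\<And>x y. x \<in> carrier W \<Longrightarrow> y \<in> carrier W \<Longrightarrow> q (x \<otimes> y) = symdiff (q x) (q y)"
    and xy: "x \<in> carrier W" "y \<in> carrier W" "support x = support y"
  shows "q x = q y"
proof -
  have parity: "z \<in> q w \<longleftrightarrow> odd (card {s \<in> support w. z \<in> q s})" if "w \<in> carrier W" for z w
    using that
  proof (induction w rule: generation_induct)
    case one
    then show ?case by (simp add: q support_one)
  next
    case (step s w)
    let ?X = "{s \<in> support w. z \<in> q s}"
    have fin: "finite ?X"
      using support_subset[OF step(2)] finite_S by (auto intro: finite_subset)
    have sup: "support (s \<otimes> w) = symdiff {s} (support w)"
      using step by (simp add: support_mult support_gen)
    have eq: "{r \<in> support (s \<otimes> w). z \<in> q r} =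
        (if z \<in> q s then if s \<in> ?X then ?X - {s} else insert s ?X else ?X)"
      unfolding sup by auto
    have "odd (card {r \<in> support (s \<otimes> w). z \<in> q r}) \<longleftrightarrow> (z \<in> q s) \<noteq> odd (card ?X)"
    proof (cases "z \<in> q s \<and> s \<in> ?X")
      case True
      then have "card ?X = Suc (card (?X - {s}))" using card_Suc_Diff1[OF fin, of s] by simp
      then have "odd (card (?X - {s})) \<longleftrightarrow> \<not> odd (card ?X)" by (simp only: even_Suc not_not)
      then show ?thesis unfolding eq using True by presburger
    next
      case False
      then show ?thesis unfolding eq using fin by simp
    qed
    moreover have "z \<in> q (s \<otimes> w) \<longleftrightarrow> (z \<in> q s) \<noteq> (z \<in> q w)"
      using step by (simp add: q)
    ultimately show ?case using step.IH by blast
  qed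
  show ?thesis unfolding set_eq_iff using parity xy by simp
qed

abbreviation commuting_set :: "'a set \<Rightarrow> bool" where
  "commuting_set \<equiv> pairwise_related (\<lambda>s t. s \<otimes> t = t \<otimes> s)"

text \<open>For noncommuting \<open>s\<close> and \<open>t\<close>, let \<open>s\<close> act on the integers by \<open>x \<mapsto> -x\<close>, let \<open>t\<close> act by
  \<open>x \<mapsto> 1 - x\<close>, and let the other generators act trivially. The sign of the action of \<open>w\<close> is the
  parity of the number of occurrences of \<open>s\<close> and \<open>t\<close> together, and the parity of its translation part is
  that of the occurrences of \<open>t\<close>. If both are in the support, \<open>w\<close> acts as a translation by an odd
  number, which is not an involution.\<close>

lemma involution_support_commuting:
  assumes w: "w \<in> carrier W" and sq: "w \<otimes> w = \<one>"
  shows "commuting_set (support w)"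
  unfolding pairwise_related_def
proof (intro ballI, rule ccontr)
  fix s t assume s: "s \<in> support w" and t: "t \<in> support w" and st: "s \<otimes> t \<noteq> t \<otimes> s"
  then have ne: "s \<noteq> t" by auto
  define F :: "'a \<Rightarrow> int \<Rightarrow> int"
    where "F r = (if r = s then uminus else if r = t then (\<lambda>x. 1 - x) else id)" for r
  obtain \<rho> where mult: "\<And>x y p. x \<in> carrier W \<Longrightarrow> y \<in> carrier W \<Longrightarrow> \<rho> (x \<otimes> y) p = \<rho> x (\<rho> y p)"
    and id: "\<And>p. \<rho> \<one> p = p" and gen: "\<And>s. s \<in> S \<Longrightarrow> \<rho> s = F s"
  proof (rule action_extension[of F])
    fix a b x assume "a \<otimes> b = b \<otimes> a"
    then show "F a (F b x) = F b (F a x)" using st by (auto simp: F_def)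
  qed (auto simp: F_def)
  have "\<exists>k. (\<forall>x. \<rho> w x = (if s \<in> support w \<longleftrightarrow> t \<in> support w then x else - x) + k) \<and>
      (odd k \<longleftrightarrow> t \<in> support w)"
    using w
  proof (induction w rule: generation_induct)
    case one
    show ?case by (intro exI[of _ 0]) (simp add: id support_one)
  next
    case (step r w)
    then obtain k where
      k: "\<And>x. \<rho> w x = (if s \<in> support w \<longleftrightarrow> t \<in> support w then x else - x) + k"
        "odd k \<longleftrightarrow> t \<in> support w" by blast
    have sup: "support (r \<otimes> w) = symdiff {r} (support w)"
      using step by (simp add: support_mult support_gen)
    show ?case
      by (intro exI[of _ "if r = s then - k else if r = t then 1 - k else k"])
         (use step k(2) ne in \<open>auto simp: sup mult gen F_def k(1)\<close>)
  qed
  then obtain k where "\<And>x. \<rho> w x = x + k" "odd k" using s t by auto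
  then have "\<rho> (w \<otimes> w) 0 \<noteq> 0" using w by (auto simp: mult)
  then show False by (simp add: sq id)
qed

text \<open>The witness is the product of the elements of \<open>A\<close>. The induction carries along that it
  commutes with whatever commutes with \<open>A\<close>.\<close>

lemma commuting_set_eq_support:
  assumes "A \<subseteq> S" "commuting_set A"
  shows "\<exists>w\<in>carrier W. w \<otimes> w = \<one> \<and> support w = A"
proof -
  have "\<exists>w\<in>carrier W. w \<otimes> w = \<one> \<and> support w = A \<and>
      (\<forall>x\<in>carrier W. (\<forall>a\<in>A. x \<otimes> a = a \<otimes> x) \<longrightarrow> x \<otimes> w = w \<otimes> x)"
    using finite_subset[OF assms(1) finite_S] assms
  proof (induction A rule: finite_induct)
    case empty
    then show ?case by (intro bexI[of _ \<one>]) (auto simp: support_one)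
  next
    case (insert s A)
    have s: "s \<in> S" "s \<in> carrier W" using insert by auto
    have "\<forall>a\<in>A. s \<otimes> a = a \<otimes> s" "commuting_set A" "A \<subseteq> S"
      using insert.prems unfolding pairwise_related_def by blast+
    then obtain w where w: "w \<in> carrier W" "w \<otimes> w = \<one>" "support w = A" "s \<otimes> w = w \<otimes> s"
      and cent: "\<And>x. x \<in> carrier W \<Longrightarrow> \<forall>a\<in>A. x \<otimes> a = a \<otimes> x \<Longrightarrow> x \<otimes> w = w \<otimes> x"
      using insert.IH s by blast
    show ?case
    proof (intro bexI[of _ "s \<otimes> w"] conjI ballI impI)
      have "(s \<otimes> w) \<otimes> (s \<otimes> w) = s \<otimes> (w \<otimes> s) \<otimes> w" using s w(1) by (simp add: m_assoc)
      also have "w \<otimes> s = s \<otimes> w" by (rule w(4)[symmetric])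
      also have "s \<otimes> (s \<otimes> w) \<otimes> w = \<one>" using s w(1,2) by simp
      finally show "(s \<otimes> w) \<otimes> (s \<otimes> w) = \<one>" .
      show "support (s \<otimes> w) = insert s A"
        using s w(1,3) insert.hyps by (auto simp: support_mult support_gen)
      fix x assume x: "x \<in> carrier W" "\<forall>a\<in>insert s A. x \<otimes> a = a \<otimes> x"
      have "x \<otimes> (s \<otimes> w) = (x \<otimes> s) \<otimes> w" using x(1) s w(1) by (simp add: m_assoc)
      also have "x \<otimes> s = s \<otimes> x" using x(2) by blast
      also have "s \<otimes> x \<otimes> w = s \<otimes> (x \<otimes> w)" using x(1) s w(1) by (simp add: m_assoc)
      also have "x \<otimes> w = w \<otimes> x" using x by (intro cent) auto
      also have "s \<otimes> (w \<otimes> x) = s \<otimes> w \<otimes> x" using x(1) s w(1) by (simp add: m_assoc)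
      finally show "x \<otimes> (s \<otimes> w) = s \<otimes> w \<otimes> x" .
    qed (use s w(1) in simp)
  qed
  then show ?thesis by blast
qed

lemma ex_support_eq:
  assumes "A \<subseteq> S"
  shows "\<exists>w\<in>carrier W. support w = A"
  using finite_subset[OF assms finite_S] assms
proof (induction A rule: finite_induct)
  case empty
  then show ?case by (intro bexI[of _ \<one>]) (auto simp: support_one)
next
  case (insert s A)
  then obtain w where "w \<in> carrier W" "support w = A" by auto
  then show ?case using insert
    by (intro bexI[of _ "s \<otimes> w"]) (auto simp: support_mult support_gen)
qed

end

section \<open>Recovering a finite graph from the linear structure of its cliques\<close>

text \<open>If \<open>a \<in> X\<close> and \<open>b \<in> Y\<close>, then one of \<open>X\<close>, \<open>Y\<close> and their symmetric difference contains both.\<close>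

lemma pairwise_related_Union:
  assumes closed: "\<And>X Y. X \<in> \<U> \<Longrightarrow> Y \<in> \<U> \<Longrightarrow> symdiff X Y \<in> \<U>"
    and related: "\<And>X. X \<in> \<U> \<Longrightarrow> pairwise_related E X"
  shows "pairwise_related E (\<Union>\<U>)"
  unfolding pairwise_related_def
proof (intro ballI)
  fix a b assume "a \<in> \<Union>\<U>" "b \<in> \<Union>\<U>"
  then obtain X Y where XY: "X \<in> \<U>" "Y \<in> \<U>" "a \<in> X" "b \<in> Y" by blast
  have "a \<in> symdiff X Y \<and> b \<in> symdiff X Y" if "a \<notin> Y" "b \<notin> X" using XY that by simp
  then obtain Z where Z: "Z \<in> \<U>" "a \<in> Z" "b \<in> Z" using XY closed[OF XY(1,2)] by blast
  then show "E a b" using related[OF Z(1)] by (simp add: pairwise_related_def)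
qed

definition maximal_cliques :: "('a \<Rightarrow> 'a \<Rightarrow> bool) \<Rightarrow> 'a set \<Rightarrow> 'a set set" where
  "maximal_cliques E S = {C. C \<subseteq> S \<and> pairwise_related E C \<and>
     (\<forall>D. D \<subseteq> S \<longrightarrow> pairwise_related E D \<longrightarrow> C \<subseteq> D \<longrightarrow> D = C)}"

lemma ex_maximal_clique:
  assumes "finite S" "X \<subseteq> S" "pairwise_related E X"
  shows "\<exists>C\<in>maximal_cliques E S. X \<subseteq> C"
proof -
  have "finite {C. C \<subseteq> S \<and> pairwise_related E C}" using assms(1) by simp
  from finite_has_maximal2[OF this, of X] obtain C where "C \<subseteq> S" "pairwise_related E C" "X \<subseteq> C"
    and "\<And>D. D \<subseteq> S \<Longrightarrow> pairwise_related E D \<Longrightarrow> C \<subseteq> D \<Longrightarrow> C = D"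
    using assms by auto
  then show ?thesis unfolding maximal_cliques_def by (intro bexI[of _ C]) auto
qed

text \<open>Here \<open>L\<close> maps the subspace of subsets of \<open>C\<close> to a subspace of cliques, whose union is a clique
  \<open>D\<close>. Conversely, the preimage of the subsets of a clique \<open>G \<supseteq> D\<close> is a subspace of cliques,
  whose union is a clique that contains \<open>C\<close>, hence equals it. Therefore \<open>G = D\<close>, and \<open>L\<close> is onto the
  subsets of \<open>D\<close>.\<close>

lemma maximal_clique_image:
  assumes L: "bij_betw L (Pow S) (Pow S')"
    and add: "\<And>X Y. X \<subseteq> S \<Longrightarrow> Y \<subseteq> S \<Longrightarrow> L (symdiff X Y) = symdiff (L X) (L Y)"
    and cliques: "\<And>X. X \<subseteq> S \<Longrightarrow> pairwise_related E' (L X) \<longleftrightarrow> pairwise_related E X"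
    and C: "C \<in> maximal_cliques E S"
  shows "\<Union> (L ` Pow C) \<in> maximal_cliques E' S'" "L ` Pow C = Pow (\<Union> (L ` Pow C))"
proof -
  define D where "D = \<Union> (L ` Pow C)"
  have CS: "C \<subseteq> S" and C_clique: "pairwise_related E C"
    and C_max: "\<And>X. X \<subseteq> S \<Longrightarrow> pairwise_related E X \<Longrightarrow> C \<subseteq> X \<Longrightarrow> X = C"
    using C by (auto simp: maximal_cliques_def)
  have L_sub: "L X \<subseteq> S'" if "X \<subseteq> S" for X using L that by (auto simp: bij_betw_def)
  have sd: "symdiff X Y \<subseteq> Z" if "X \<subseteq> Z" "Y \<subseteq> Z" for X Y Z :: "'x set"
    using that by (auto simp: symdiff_def)
  have D_sub: "D \<subseteq> S'" using L_sub CS by (auto simp: D_def)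
  have D_clique: "pairwise_related E' D"
    unfolding D_def
  proof (rule pairwise_related_Union)
    fix X Y assume "X \<in> L ` Pow C" "Y \<in> L ` Pow C"
    then obtain A B where "A \<subseteq> C" "B \<subseteq> C" "X = L A" "Y = L B" by auto
    then show "symdiff X Y \<in> L ` Pow C"
      using add[of A B] CS sd[of A C B] by (intro image_eqI[of _ _ "symdiff A B"]) auto
  next
    fix X assume "X \<in> L ` Pow C"
    then obtain A where "A \<subseteq> C" "X = L A" by auto
    then show "pairwise_related E' X"
      using cliques[of A] C_clique CS by (auto simp: pairwise_related_def)
  qed
  have sub: "Pow G \<subseteq> L ` Pow C" if G: "G \<subseteq> S'" "pairwise_related E' G" "D \<subseteq> G" for G
  proof -
    define \<U> where "\<U> = {X. X \<subseteq> S \<and> L X \<subseteq> G}"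
    have "pairwise_related E (\<Union>\<U>)"
    proof (rule pairwise_related_Union)
      show "symdiff X Y \<in> \<U>" if "X \<in> \<U>" "Y \<in> \<U>" for X Y
        using that add[of X Y] sd[of X S Y] sd[of "L X" G "L Y"] by (auto simp: \<U>_def simp del: in_symdiff)
      show "pairwise_related E X" if "X \<in> \<U>" for X
        using that cliques[of X] G(2) by (auto simp: \<U>_def pairwise_related_def)
    qed
    moreover have "C \<in> \<U>" using CS G(3) by (auto simp: \<U>_def D_def)
    ultimately have "\<Union>\<U> = C" by (intro C_max) (auto simp: \<U>_def)
    have "Y \<in> L ` Pow C" if Y: "Y \<subseteq> G" for Y
    proof -
      have "Y \<in> L ` Pow S" using L Y G(1) by (auto simp: bij_betw_def)
      then obtain X where "X \<subseteq> S" "Y = L X" by auto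
      then show ?thesis using \<open>\<Union>\<U> = C\<close> Y by (auto simp: \<U>_def)
    qed
    then show ?thesis by auto
  qed
  show "L ` Pow C = Pow (\<Union> (L ` Pow C))"
    using sub[OF D_sub D_clique] by (auto simp: D_def)
  have "G = D" if G: "G \<subseteq> S'" "pairwise_related E' G" "D \<subseteq> G" for G
  proof -
    have "G \<in> L ` Pow C" using sub[OF G] by auto
    then have "G \<subseteq> D" unfolding D_def by (rule Union_upper)
    with G(3) show ?thesis by simp
  qed
  then show "\<Union> (L ` Pow C) \<in> maximal_cliques E' S'"
    unfolding maximal_cliques_def D_def[symmetric] using D_sub D_clique by simp
qed

text \<open>The cardinalities determine, by inclusion-exclusion, how often each set occurs as a value of
  \<open>T\<close> and of \<open>T'\<close>. Instead of computing these numbers, an element with a maximal value \<open>T s\<close> is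
  matched with one with the same value \<open>T' s'\<close>, and both are removed.\<close>

lemma ex_bij_betw_of_card_eq:
  assumes "finite S" "finite S'" and "\<And>s. s \<in> S \<Longrightarrow> finite (T s)" "\<And>s. s \<in> S' \<Longrightarrow> finite (T' s)"
    and "\<And>J. card {s\<in>S. J \<subseteq> T s} = card {s\<in>S'. J \<subseteq> T' s}"
  shows "\<exists>f. bij_betw f S S' \<and> (\<forall>s\<in>S. T' (f s) = T s)"
  using assms
proof (induction "card S" arbitrary: S S')
  case 0
  have "card S = card S'" using 0(6)[of "{}"] by simp
  then show ?case using 0 by (auto simp: bij_betw_def)
next
  case (Suc n)
  have "finite (T ` S)" "T ` S \<noteq> {}" using Suc by auto
  from finite_has_maximal[OF this] obtain s where s: "s \<in> S"
    and max: "\<And>r. r \<in> S \<Longrightarrow> T s \<subseteq> T r \<Longrightarrow> T r = T s" by auto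
  have "card {r\<in>S. T s \<subseteq> T r} \<noteq> 0" using Suc.prems(1) s by auto
  then have "{r\<in>S'. T s \<subseteq> T' r} \<noteq> {}" unfolding Suc.prems(5) by (metis card.empty)
  then obtain s' where s': "s' \<in> S'" "T s \<subseteq> T' s'" by auto
  have "card {r\<in>S'. T' s' \<subseteq> T' r} \<noteq> 0" using Suc.prems(2) s' by auto
  then have "{r\<in>S. T' s' \<subseteq> T r} \<noteq> {}" unfolding Suc.prems(5)[symmetric] by (metis card.empty)
  then obtain r where r: "r \<in> S" "T' s' \<subseteq> T r" by auto
  have eq: "T' s' = T s" using max[of r] r s'(2) by auto
  have "\<exists>f. bij_betw f (S - {s}) (S' - {s'}) \<and> (\<forall>s\<in>S - {s}. T' (f s) = T s)"
  proof (rule Suc.hyps(1))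
    show "n = card (S - {s})" using Suc.hyps(2) s Suc.prems(1) by simp
    fix J
    have "{r \<in> S - {s}. J \<subseteq> T r} = {r \<in> S. J \<subseteq> T r} - {s}"
      "{r \<in> S' - {s'}. J \<subseteq> T' r} = {r \<in> S'. J \<subseteq> T' r} - {s'}" by auto
    then show "card {r \<in> S - {s}. J \<subseteq> T r} = card {r \<in> S' - {s'}. J \<subseteq> T' r}"
      using Suc.prems(1,2) Suc.prems(5)[of J] s s' eq by (simp add: card_Diff_singleton_if)
  qed (use Suc.prems in auto)
  then obtain f where f: "bij_betw f (S - {s}) (S' - {s'})" "\<forall>r\<in>S - {s}. T' (f r) = T r" by blast
  have "bij_betw (f(s := s')) (S - {s}) (S' - {s'})"
    using f(1) by (rule iffD1[OF bij_betw_cong, rotated]) simp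
  then have "bij_betw (f(s := s')) (S - {s} \<union> {s}) (S' - {s'} \<union> {s'})"
    by (rule bij_betw_combine) (auto simp: bij_betw_def)
  then have "bij_betw (f(s := s')) S S'" using s s' by (simp add: insert_absorb)
  then show ?case using f(2) eq by (intro exI[of _ "f(s := s')"]) auto
qed

text \<open>Two vertices are adjacent if and only if some maximal clique contains both, so it is
  enough to match vertices that lie in corresponding collections of maximal cliques. The number of
  vertices common to the cliques in \<open>J\<close> is the dimension of an intersection of subspaces, which \<open>L\<close>
  preserves.\<close>

theorem clique_preserving_imp_graph_iso:
  assumes fin: "finite S" "finite S'"
    and sym: "\<And>s t. E s t \<Longrightarrow> E t s" "\<And>s t. E' s t \<Longrightarrow> E' t s"
    and refl: "\<And>s. s \<in> S \<Longrightarrow> E s s" "\<And>s. s \<in> S' \<Longrightarrow> E' s s"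
    and L: "bij_betw L (Pow S) (Pow S')"
    and add: "\<And>X Y. X \<subseteq> S \<Longrightarrow> Y \<subseteq> S \<Longrightarrow> L (symdiff X Y) = symdiff (L X) (L Y)"
    and cliques: "\<And>X. X \<subseteq> S \<Longrightarrow> pairwise_related E' (L X) \<longleftrightarrow> pairwise_related E X"
  shows "\<exists>f. bij_betw f S S' \<and> (\<forall>s\<in>S. \<forall>t\<in>S. E' (f s) (f t) \<longleftrightarrow> E s t)"
proof -
  let ?M = "maximal_cliques E S" and ?M' = "maximal_cliques E' S'"
  define c where "c C = \<Union> (L ` Pow C)" for C
  have image: "c C \<in> ?M'" "L ` Pow C = Pow (c C)" if "C \<in> ?M" for C
    unfolding c_def by (rule maximal_clique_image[OF L _ _ that]; use add cliques in blast)+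
  have inj: "inj_on L (Pow S)" and LS: "L ` Pow S = Pow S'" using L by (auto simp: bij_betw_def)
  have M_sub: "C \<subseteq> S" if "C \<in> ?M" for C using that by (simp add: maximal_cliques_def)
  have subset_iff: "L X \<subseteq> c C \<longleftrightarrow> X \<subseteq> C" if "C \<in> ?M" "X \<subseteq> S" for C X
  proof -
    have "L X \<subseteq> c C \<longleftrightarrow> L X \<in> L ` Pow C" using image(2)[OF that(1)] by auto
    also have "\<dots> \<longleftrightarrow> X \<in> Pow C"
      using inj M_sub[OF that(1)] that(2) by (intro inj_on_image_mem_iff) auto
    finally show ?thesis by simp
  qed
  \<comment> \<open>The inverse of \<open>L\<close> has the same properties as \<open>L\<close>.\<close>
  have surj: "\<exists>C\<in>?M. c C = D" if D: "D \<in> ?M'" for D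
  proof -
    let ?K = "inv_into (Pow S) L"
    have K: "bij_betw ?K (Pow S') (Pow S)" using L by (rule bij_betw_inv_into)
    have KL: "?K (L X) = X" if "X \<subseteq> S" for X using inj that by (intro inv_into_f_f) auto
    have LK: "L (?K Y) = Y" "?K Y \<subseteq> S" if "Y \<subseteq> S'" for Y
      using that LS f_inv_into_f[of Y L "Pow S"] inv_into_into[of Y L "Pow S"] by auto
    have K_add: "?K (symdiff X Y) = symdiff (?K X) (?K Y)" if XY: "X \<subseteq> S'" "Y \<subseteq> S'" for X Y
    proof -
      have "symdiff (?K X) (?K Y) \<subseteq> S" using LK(2) XY unfolding symdiff_def by blast
      then show ?thesis
        using KL[of "symdiff (?K X) (?K Y)"] add[of "?K X" "?K Y"] LK XY by simp
    qed
    have K_cliques: "pairwise_related E (?K Y) \<longleftrightarrow> pairwise_related E' Y" if "Y \<subseteq> S'" for Y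
      using cliques[of "?K Y"] LK[OF that] by simp
    have C: "\<Union> (?K ` Pow D) \<in> ?M" "?K ` Pow D = Pow (\<Union> (?K ` Pow D))"
      by (rule maximal_clique_image[OF K _ _ D]; use K_add K_cliques in blast)+
    have "L ` Pow (\<Union> (?K ` Pow D)) = L ` ?K ` Pow D" using C(2) by simp
    also have "\<dots> = (\<lambda>Y. Y) ` Pow D"
      unfolding image_image using D by (intro image_cong) (auto simp: LK maximal_cliques_def)
    finally have "c (\<Union> (?K ` Pow D)) = D" by (simp add: c_def)
    then show ?thesis using C(1) by blast
  qed
  have edge: "E s t \<longleftrightarrow> (\<exists>C\<in>?M. s \<in> C \<and> t \<in> C)" if "s \<in> S" "t \<in> S" for s t
  proof
    assume st: "E s t"
    then have "pairwise_related E {s, t}" using that sym(1)[OF st] refl(1) by (auto simp: pairwise_related_def)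
    then show "\<exists>C\<in>?M. s \<in> C \<and> t \<in> C" using ex_maximal_clique[OF fin(1), of "{s, t}" E] that by auto
  qed (auto simp: maximal_cliques_def pairwise_related_def)
  have edge': "E' s t \<longleftrightarrow> (\<exists>C\<in>?M. s \<in> c C \<and> t \<in> c C)" if elems: "s \<in> S'" "t \<in> S'" for s t
  proof
    assume st: "E' s t"
    then have "pairwise_related E' {s, t}" using elems sym(2)[OF st] refl(2) by (auto simp: pairwise_related_def)
    then obtain D where "D \<in> ?M'" "s \<in> D" "t \<in> D"
      using ex_maximal_clique[OF fin(2), of "{s, t}" E'] elems by auto
    then show "\<exists>C\<in>?M. s \<in> c C \<and> t \<in> c C" using surj by metis
  next
    assume "\<exists>C\<in>?M. s \<in> c C \<and> t \<in> c C"
    then show "E' s t" using image(1) by (auto simp: maximal_cliques_def pairwise_related_def)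
  qed
  \<comment> \<open>Both sides are indexed by the maximal cliques of \<open>E\<close>, so that
    \<open>T\<close> and \<open>T'\<close> have values in the same type.\<close>
  define T where "T s = {C \<in> ?M. s \<in> C}" for s
  define T' where "T' s = {C \<in> ?M. s \<in> c C}" for s
  have finM: "finite ?M"
    using fin by (intro finite_subset[of ?M "Pow S"]) (auto simp: maximal_cliques_def)
  have "\<exists>f. bij_betw f S S' \<and> (\<forall>s\<in>S. T' (f s) = T s)"
  proof (rule ex_bij_betw_of_card_eq[OF fin])
    fix J
    show "card {s \<in> S. J \<subseteq> T s} = card {s \<in> S'. J \<subseteq> T' s}"
    proof (cases "J \<subseteq> ?M")
      case True
      let ?X = "{s \<in> S. J \<subseteq> T s}" and ?Y = "{s \<in> S'. J \<subseteq> T' s}"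
      have X: "A \<subseteq> ?X \<longleftrightarrow> (\<forall>C\<in>J. A \<subseteq> C)" if "A \<subseteq> S" for A
        using that True by (auto simp: T_def)
      have Y: "B \<subseteq> ?Y \<longleftrightarrow> (\<forall>C\<in>J. B \<subseteq> c C)" if "B \<subseteq> S'" for B
        using that True by (auto simp: T'_def)
      have iff: "L A \<subseteq> ?Y \<longleftrightarrow> A \<subseteq> ?X" if "A \<subseteq> S" for A
      proof -
        have LA: "L A \<subseteq> S'" using LS that by auto
        have "L A \<subseteq> c C \<longleftrightarrow> A \<subseteq> C" if "C \<in> J" for C
          using subset_iff[of C A] that True \<open>A \<subseteq> S\<close> by auto
        then show ?thesis unfolding X[OF that] Y[OF LA] by simp
      qed
      have "L ` Pow ?X = Pow ?Y"
      proof (intro equalityI subsetI)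
        fix B assume "B \<in> L ` Pow ?X"
        then obtain A where "A \<subseteq> ?X" "B = L A" by auto
        moreover from this have "A \<subseteq> S" by auto
        ultimately show "B \<in> Pow ?Y" using iff by auto
      next
        fix B assume B: "B \<in> Pow ?Y"
        then have "B \<in> L ` Pow S" unfolding LS by auto
        then show "B \<in> L ` Pow ?X" using iff B by auto
      qed
      moreover have "inj_on L (Pow ?X)" using inj by (rule inj_on_subset) auto
      ultimately have "card (Pow ?X) = card (Pow ?Y)" by (metis card_image)
      then show ?thesis using fin by (simp add: card_Pow)
    next
      case False
      then have "\<not> J \<subseteq> T s" "\<not> J \<subseteq> T' s'" for s s' by (auto simp: T_def T'_def)
      then show ?thesis by simp
    qed
  qed (use finM in \<open>auto simp: T_def T'_def\<close>)
  then obtain f where f: "bij_betw f S S'" "\<And>s. s \<in> S \<Longrightarrow> T' (f s) = T s" by blast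
  have "E' (f s) (f t) \<longleftrightarrow> E s t" if st: "s \<in> S" "t \<in> S" for s t
  proof -
    have "f s \<in> S'" "f t \<in> S'" using f(1) st by (auto simp: bij_betw_def)
    then have "E' (f s) (f t) \<longleftrightarrow> T' (f s) \<inter> T' (f t) \<noteq> {}"
      by (subst edge') (auto simp: T'_def)
    also have "\<dots> \<longleftrightarrow> E s t" using f(2) st by (subst edge) (auto simp: T_def)
    finally show ?thesis .
  qed
  with f(1) show ?thesis by blast
qed

section \<open>Rigidity\<close>

lemma right_angled_imp_commuting_coxeter:
  assumes "right_angled_coxeter_system W S"
  shows "\<exists>m. commuting_coxeter W S m"
proof -
  obtain m where sys: "coxeter_system_with W S m"
    and m: "\<And>s t. s \<in> S \<Longrightarrow> t \<in> S \<Longrightarrow> s \<noteq> t \<Longrightarrow> m s t \<in> {2, \<infinity>}"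
    using assms by (auto simp: right_angled_coxeter_system_def)
  interpret coxeter W S m by unfold_locales (rule sys)
  have comm: "s \<otimes>\<^bsub>W\<^esub> t = t \<otimes>\<^bsub>W\<^esub> s" if st: "s \<in> S" "t \<in> S" "m s t \<noteq> \<infinity>" for s t
  proof (cases "s = t")
    case False
    then have "m s t = enat 2" using m[OF st(1,2)] st(3) by (auto simp: numeral_eq_enat)
    then have "(s \<otimes>\<^bsub>W\<^esub> t) \<otimes>\<^bsub>W\<^esub> (s \<otimes>\<^bsub>W\<^esub> t) = \<one>\<^bsub>W\<^esub>"
      using generator_relation[OF st(1,2)] st by (simp add: numeral_2_eq_2)
    then show ?thesis using commute_of_square_one[OF st(1,2)] by simp
  qed simp
  have "commuting_coxeter W S m" by unfold_locales (rule comm)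
  then show ?thesis by blast
qed

text \<open>A finite label \<open>m' s t\<close> makes \<open>s \<otimes> t\<close> a torsion element, so its square is trivial by
  \<open>torsion_square\<close>, which says that the involutions \<open>s\<close> and \<open>t\<close> commute.\<close>

lemma (in commuting_coxeter) coxeter_system_imp_commuting_coxeter:
  assumes "coxeter_system W S'"
  shows "\<exists>m'. commuting_coxeter W S' m'"
proof -
  obtain m' where sys: "coxeter_system_with W S' m'"
    using assms by (auto simp: coxeter_system_def)
  interpret S': coxeter W S' m' by unfold_locales (rule sys)
  have comm: "s \<otimes> t = t \<otimes> s" if st: "s \<in> S'" "t \<in> S'" "m' s t \<noteq> \<infinity>" for s t
  proof (cases "s = t")
    case False
    obtain n where n: "m' s t = enat n" using st by auto
    have "n > 0" using S'.label_ge2[OF st(1,2) False] n by (cases n) (auto simp: numeral_eq_enat)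
    then have "(s \<otimes> t) \<otimes> (s \<otimes> t) = \<one>"
      using torsion_square S'.generator_relation[OF st(1,2) n] st by simp
    then show ?thesis by (rule S'.commute_of_square_one[OF st(1,2)])
  qed simp
  have "commuting_coxeter W S' m'" by unfold_locales (rule comm)
  then show ?thesis by blast
qed

context
  fixes W :: "('a, 'b) monoid_scheme" (structure) and S S' m m'
  assumes S: "commuting_coxeter W S m" and S': "commuting_coxeter W S' m'"
begin

interpretation S: commuting_coxeter W S m by (rule S)
interpretation S': commuting_coxeter W S' m' by (rule S')

lemma support_eq_iff:
  assumes "x \<in> carrier W" "y \<in> carrier W"
  shows "S.support x = S.support y \<longleftrightarrow> S'.support x = S'.support y"
proof
  show "S'.support x = S'.support y" if "S.support x = S.support y"
    using S'.support_one S'.support_mult assms that by (rule S.hom_determined_by_support)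
  show "S.support x = S.support y" if "S'.support x = S'.support y"
    using S.support_one S.support_mult assms that by (rule S'.hom_determined_by_support)
qed

text \<open>The map \<open>L\<close> from \<open>S\<close>-supports to \<open>S'\<close>-supports preserves cliques in both directions,
  since on both sides cliques are the supports of the elements \<open>w\<close> with \<open>w\<^sup>2 = 1\<close>.\<close>

lemma ex_commutation_iso:
  "\<exists>f. bij_betw f S S' \<and> (\<forall>s\<in>S. \<forall>t\<in>S. f s \<otimes> f t = f t \<otimes> f s \<longleftrightarrow> s \<otimes> t = t \<otimes> s)"
proof -
  define rep where "rep X = (SOME w. w \<in> carrier W \<and> S.support w = X)" for X
  have rep: "rep X \<in> carrier W" "S.support (rep X) = X" if "X \<subseteq> S" for X
    using someI_ex[of "\<lambda>w. w \<in> carrier W \<and> S.support w = X"] S.ex_support_eq[OF that]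
    unfolding rep_def by auto
  define L where "L X = S'.support (rep X)" for X
  have L: "L (S.support w) = S'.support w" if "w \<in> carrier W" for w
    unfolding L_def using support_eq_iff[of w "rep (S.support w)"] that rep[OF S.support_subset[OF that]] by simp
  show ?thesis
  proof (rule clique_preserving_imp_graph_iso)
    show "bij_betw L (Pow S) (Pow S')"
    proof (rule bij_betw_imageI)
      show "inj_on L (Pow S)"
      proof (rule inj_onI)
        fix X Y assume "X \<in> Pow S" "Y \<in> Pow S" "L X = L Y"
        then show "X = Y" using support_eq_iff[of "rep X" "rep Y"] rep by (simp add: L_def)
      qed
      show "L ` Pow S = Pow S'"
      proof (intro equalityI subsetI)
        fix Y assume "Y \<in> L ` Pow S"
        then show "Y \<in> Pow S'" using S'.support_subset rep by (auto simp: L_def)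
      next
        fix Y assume "Y \<in> Pow S'"
        then obtain w where "w \<in> carrier W" "S'.support w = Y" using S'.ex_support_eq by blast
        then show "Y \<in> L ` Pow S"
          using L S.support_subset by (intro image_eqI[of _ _ "S.support w"]) auto
      qed
    qed
  next
    fix X Y assume "X \<subseteq> S" "Y \<subseteq> S"
    then show "L (symdiff X Y) = symdiff (L X) (L Y)"
      using L[of "rep X \<otimes> rep Y"] rep by (simp add: S.support_mult S'.support_mult L_def)
  next
    fix X assume X: "X \<subseteq> S"
    show "S.commuting_set (L X) \<longleftrightarrow> S.commuting_set X"
    proof
      assume "S.commuting_set (L X)"
      moreover have "L X \<subseteq> S'" using X rep S'.support_subset by (simp add: L_def)
      ultimately obtain w where w: "w \<in> carrier W" "w \<otimes> w = \<one>" "S'.support w = L X"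
        using S'.commuting_set_eq_support by blast
      then have "S.support w = X" using support_eq_iff[of w "rep X"] rep[OF X] by (simp add: L_def)
      then show "S.commuting_set X" using S.involution_support_commuting w by blast
    next
      assume "S.commuting_set X"
      then obtain w where "w \<in> carrier W" "w \<otimes> w = \<one>" "S.support w = X"
        using S.commuting_set_eq_support[OF X] by blast
      then show "S.commuting_set (L X)" using S'.involution_support_commuting L by metis
    qed
  qed (use S.finite_S S'.finite_S in auto)
qed

lemma hom_of_commutation_iso:
  assumes f: "f \<in> S \<rightarrow> S'"
    and comm: "\<And>s t. s \<in> S \<Longrightarrow> t \<in> S \<Longrightarrow> s \<otimes> t = t \<otimes> s \<Longrightarrow> f s \<otimes> f t = f t \<otimes> f s"
  shows "\<exists>h\<in>hom W W. h \<one> = \<one> \<and> (\<forall>s\<in>S. h s = f s)"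
proof -
  have "f \<in> S \<rightarrow> carrier W" using f S'.gen_closed by blast
  then show ?thesis
    by (rule S.involution_hom_extension[OF S.monoid_axioms]) (use f comm S'.gen_square in auto)
qed

end

lemma commuting_coxeter_equivalent:
  assumes S: "commuting_coxeter W S m" and S': "commuting_coxeter W S' m'"
  shows "coxeter_systems_equivalent W S W S'"
proof -
  interpret S: commuting_coxeter W S m by (rule S)
  interpret S': commuting_coxeter W S' m' by (rule S')
  obtain f where f: "bij_betw f S S'"
    and comm: "\<And>s t. s \<in> S \<Longrightarrow> t \<in> S \<Longrightarrow>
      f s \<otimes>\<^bsub>W\<^esub> f t = f t \<otimes>\<^bsub>W\<^esub> f s \<longleftrightarrow> s \<otimes>\<^bsub>W\<^esub> t = t \<otimes>\<^bsub>W\<^esub> s"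
    using ex_commutation_iso[OF S S'] by blast
  define g where "g = inv_into S f"
  have fS: "f s \<in> S'" "g (f s) = s" if "s \<in> S" for s
    using f that by (auto simp: g_def bij_betw_def)
  have gS: "g s \<in> S" "f (g s) = s" if "s \<in> S'" for s
    using f that by (auto simp: g_def bij_betw_def inv_into_into f_inv_into_f)
  obtain h where h: "h \<in> hom W W" "h \<one>\<^bsub>W\<^esub> = \<one>\<^bsub>W\<^esub>" "\<And>s. s \<in> S \<Longrightarrow> h s = f s"
    using hom_of_commutation_iso[OF S S', of f] fS(1) comm by blast
  have comm': "g s \<otimes>\<^bsub>W\<^esub> g t = g t \<otimes>\<^bsub>W\<^esub> g s"
    if "s \<in> S'" "t \<in> S'" "s \<otimes>\<^bsub>W\<^esub> t = t \<otimes>\<^bsub>W\<^esub> s" for s t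
    using comm[of "g s" "g t"] gS that by simp
  obtain k where k: "k \<in> hom W W" "k \<one>\<^bsub>W\<^esub> = \<one>\<^bsub>W\<^esub>" "\<And>s. s \<in> S' \<Longrightarrow> k s = g s"
    using hom_of_commutation_iso[OF S' S, of g] gS(1) comm' by blast
  have kh: "k (h w) = w" if "w \<in> carrier W" for w
    using that
    by (induction w rule: S.generation_induct)
       (use h k fS in \<open>auto simp: hom_mult hom_in_carrier\<close>)
  have hk: "h (k w) = w" if "w \<in> carrier W" for w
    using that
    by (induction w rule: S'.generation_induct)
       (use h k gS in \<open>auto simp: hom_mult hom_in_carrier\<close>)
  have "bij_betw h (carrier W) (carrier W)"
    using h(1) k(1) kh hk by (intro bij_betw_byWitness[of _ k]) (auto simp: hom_def)
  then have "h \<in> iso W W" using h(1) by (simp add: iso_def)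
  moreover have "h ` S = S'" using f h(3) by (auto simp: bij_betw_def)
  ultimately show ?thesis by (auto simp: coxeter_systems_equivalent_def)
qed

theorem theorem1:
  fixes W :: "('a, 'b) monoid_scheme" and S S' :: "'a set"
  assumes "right_angled_coxeter_group W"
    and "coxeter_system W S"
    and "coxeter_system W S'"
  shows "coxeter_systems_equivalent W S W S'"
proof -
  obtain S\<^sub>0 m\<^sub>0 where "commuting_coxeter W S\<^sub>0 m\<^sub>0"
    using assms(1) right_angled_imp_commuting_coxeter
    unfolding right_angled_coxeter_group_def by blast
  then show ?thesis
    using commuting_coxeter.coxeter_system_imp_commuting_coxeter commuting_coxeter_equivalent
      assms(2,3) by metis
qed

end
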